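(* Let $V,W$ be finite-dimensional vector spaces over $\mathbb{K}\in\{\mathbb{R},\mathbb{C}\}$, let $(V,\mu)$ and $(W,\nu)$ be Lie algebras, let $f:(V,\mu)\to(W,\nu)$ be a morphism of Lie algebras, and assume that $f(V)\subseteq U$, where $U\subseteq W$ is a Lie subalgebra. If $$H^1_{CE}(V,W/U)=0,$$ then there is an open neighborhood $\mathcal{U}$ of $f$ in the set of Lie algebra morphisms $(V,\mu)\to(W,\nu)$ such that for every $f'\in\mathcal{U}$ there exists a family $I\subseteq W$, parametrized by an open neighborhood of $0$ in $\{[w]\in W/U\mid \nu(w,f(V))\subseteq U\}$, such that for every $w\in I$ we have $f'(V)\subseteq\exp(\mathrm{ad}_w)(U)$.
   Context: $\mathrm{ad}_w=\nu(w,-)\in\mathrm{End}(W)$. The vector space $W/U$ is a $(V,\mu)$-module through $f$: $x\in V$ acts by $[w]\mapsto[\nu(f(x),w)]$, which is well defined since $f(V)\subseteq U$ and $U$ is a subalgebra. $H^\bullet_{CE}(V,W/U)$ is the standard Chevalley–Eilenberg cohomology of the Lie algebra $(V,\mu)$ with values in this module. The set of Lie algebra morphisms has the subspace topology from the space of linear maps $V\to W$. A family in a set $X$ parametrized by $O$ is (the image of) a map $O\to X$. *)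

theory Defs
  imports
    "HOL-Analysis.Analysis"
    "HOL-Algebra.Module"
    "HOL-Library.Set_Algebras"
begin

section \<open>The ground field\<close>

text \<open>
  The normed fields that are isometrically isomorphic to the real or to the complex numbers.
\<close>

class real_or_complex = real_normed_field +
  assumes ex_embedding_complex:
    "\<exists>h :: 'a \<Rightarrow> complex.
       (\<forall>x y. h (x + y) = h x + h y) \<and> (\<forall>x y. h (x * y) = h x * h y) \<and> h 1 = 1 \<and>
       (\<forall>x. norm (h x) = norm x) \<and> (range h = \<real> \<or> range h = UNIV)"

instance real :: real_or_complex
  by standard (rule exI[of _ complex_of_real], auto simp: Reals_def)

instance complex :: real_or_complex
  by standard (rule exI[of _ "\<lambda>x. x"], auto)


section \<open>Topologies\<close>

text \<open>
  The canonical topology of a finite-dimensional vector space, described without choosing a basis: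
  the coarsest topology for which all linear functionals are continuous.  In coordinates with
  respect to any basis it is the product topology.
\<close>

definition fd_topology :: "('k::real_or_complex \<Rightarrow> 'a::ab_group_add \<Rightarrow> 'a) \<Rightarrow> 'a topology" where
  "fd_topology sc =
     topology_generated_by {\<phi> -` S | \<phi> S. Vector_Spaces.linear sc (*) \<phi> \<and> open S}"

text \<open>
  For finite-dimensional spaces, pointwise convergence is the canonical topology on the vector
  space of linear maps.
\<close>

definition linear_map_topology ::
  "('k::real_or_complex \<Rightarrow> 'a::ab_group_add \<Rightarrow> 'a) \<Rightarrow> ('k \<Rightarrow> 'b::ab_group_add \<Rightarrow> 'b) \<Rightarrow> ('a \<Rightarrow> 'b) topology" where
  "linear_map_topology sV sW =
     subtopology (product_topology (\<lambda>_. fd_topology sW) UNIV) {g. Vector_Spaces.linear sV sW g}"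

definition quotient_topology :: "'a topology \<Rightarrow> ('a \<Rightarrow> 'b) \<Rightarrow> 'b topology" where
  "quotient_topology X p =
     topology (\<lambda>T. T \<subseteq> p ` topspace X \<and> openin X {x \<in> topspace X. p x \<in> T})"

lemma openin_quotient_topology:
  "openin (quotient_topology X p) T \<longleftrightarrow>
     T \<subseteq> p ` topspace X \<and> openin X {x \<in> topspace X. p x \<in> T}"
proof -
  have "istopology (\<lambda>T. T \<subseteq> p ` topspace X \<and> openin X {x \<in> topspace X. p x \<in> T})"
    unfolding istopology_def
  proof (intro conjI allI impI; (elim conjE)?)
    fix S T
    assume "openin X {x \<in> topspace X. p x \<in> S}" "openin X {x \<in> topspace X. p x \<in> T}"
    then have "openin X ({x \<in> topspace X. p x \<in> S} \<inter> {x \<in> topspace X. p x \<in> T})"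
      by (rule openin_Int)
    then show "openin X {x \<in> topspace X. p x \<in> S \<inter> T}"
      by (rule back_subst) auto
  next
    fix \<K>
    assume *: "\<forall>T\<in>\<K>. T \<subseteq> p ` topspace X \<and> openin X {x \<in> topspace X. p x \<in> T}"
    have "openin X (\<Union>T\<in>\<K>. {x \<in> topspace X. p x \<in> T})"
      using * by blast
    then show "openin X {x \<in> topspace X. p x \<in> \<Union>\<K>}"
      by (rule back_subst) auto
  qed blast+
  then show ?thesis
    by (simp add: quotient_topology_def topology_inverse')
qed

text \<open>The exponential series of an endomorphism, evaluated at a vector.\<close>

definition exp_end :: "('k::real_or_complex \<Rightarrow> 'a::ab_group_add \<Rightarrow> 'a) \<Rightarrow> ('a \<Rightarrow> 'a) \<Rightarrow> 'a \<Rightarrow> 'a" where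
  "exp_end sc T x =
     (THE y. limitin (fd_topology sc) (\<lambda>n. \<Sum>k<n. sc (inverse (fact k)) ((T ^^ k) x)) y sequentially)"


section \<open>Lie algebras\<close>

locale lie_algebra = vector_space sc
  for sc :: "'k::field \<Rightarrow> 'a::ab_group_add \<Rightarrow> 'a" +
  fixes bracket :: "'a \<Rightarrow> 'a \<Rightarrow> 'a"
  assumes linear_left: "Vector_Spaces.linear sc sc (\<lambda>x. bracket x y)"
    and linear_right: "Vector_Spaces.linear sc sc (\<lambda>y. bracket x y)"
    and alternating: "bracket x x = 0"
    and jacobi: "bracket x (bracket y z) + bracket y (bracket z x) + bracket z (bracket x y) = 0"

definition lie_hom ::
  "('k::field \<Rightarrow> 'a::ab_group_add \<Rightarrow> 'a) \<Rightarrow> ('a \<Rightarrow> 'a \<Rightarrow> 'a) \<Rightarrow>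
   ('k \<Rightarrow> 'b::ab_group_add \<Rightarrow> 'b) \<Rightarrow> ('b \<Rightarrow> 'b \<Rightarrow> 'b) \<Rightarrow> ('a \<Rightarrow> 'b) \<Rightarrow> bool" where
  "lie_hom sV \<mu> sW \<nu> f \<longleftrightarrow>
     Vector_Spaces.linear sV sW f \<and> (\<forall>x y. f (\<mu> x y) = \<nu> (f x) (f y))"

definition lie_subalgebra ::
  "('k::field \<Rightarrow> 'a::ab_group_add \<Rightarrow> 'a) \<Rightarrow> ('a \<Rightarrow> 'a \<Rightarrow> 'a) \<Rightarrow> 'a set \<Rightarrow> bool" where
  "lie_subalgebra sc \<nu> U \<longleftrightarrow>
     Modules.module.subspace sc U \<and> (\<forall>x\<in>U. \<forall>y\<in>U. \<nu> x y \<in> U)"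


section \<open>The quotient space and its module structure\<close>

text \<open>
  The quotient space is the set of cosets \<open>w +o U\<close>.  The translate by \<open>U\<close> in the scalar
  multiplication matters for the scalar \<open>0\<close>.  The multiplicative part of the record carries
  no meaning for a module.
\<close>

definition quotient_module ::
  "('k::field \<Rightarrow> 'a::ab_group_add \<Rightarrow> 'a) \<Rightarrow> 'a set \<Rightarrow> ('k, 'a set) module" where
  "quotient_module sc U =
     \<lparr>carrier = range (\<lambda>w. w +o U), mult = undefined, one = undefined,
      zero = U, add = (\<lambda>A B. A + B), smult = (\<lambda>c A. \<Union>a\<in>A. sc c a +o U)\<rparr>"

definition quotient_action ::
  "('b::ab_group_add \<Rightarrow> 'b \<Rightarrow> 'b) \<Rightarrow> ('a \<Rightarrow> 'b) \<Rightarrow> 'b set \<Rightarrow> 'a \<Rightarrow> 'b set \<Rightarrow> 'b set" where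
  "quotient_action \<nu> f U x A = (\<Union>a\<in>A. \<nu> (f x) a +o U)"

context
  fixes sc :: "'k::field \<Rightarrow> 'a::ab_group_add \<Rightarrow> 'a" and U :: "'a set"
  assumes vs: "vector_space sc" and U: "Modules.module.subspace sc U"
begin

interpretation vector_space sc by (rule vs)

lemma coset_eq_iff: "a +o U = b +o U \<longleftrightarrow> a - b \<in> U"
proof
  assume "a +o U = b +o U"
  moreover have "a \<in> a +o U"
    using subspace_0[OF U] by (force simp: elt_set_plus_def)
  ultimately show "a - b \<in> U"
    by (auto simp: elt_set_plus_def)
next
  assume d: "a - b \<in> U"
  have "\<exists>v\<in>U. a + u = b + v" if "u \<in> U" for u
    using subspace_add[OF U d that] by (intro bexI[of _ "a - b + u"]) auto
  moreover have "\<exists>v\<in>U. b + u = a + v" if "u \<in> U" for u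
    using subspace_diff[OF U that d] by (intro bexI[of _ "u - (a - b)"]) auto
  ultimately show "a +o U = b +o U"
    unfolding elt_set_plus_def by blast
qed

lemma quotient_module_add:
  "(a +o U) \<oplus>\<^bsub>quotient_module sc U\<^esub> (b +o U) = (a + b) +o U"
proof -
  have "U + U = U"
  proof
    show "U + U \<subseteq> U"
      using subspace_add[OF U] by (auto simp: set_plus_def)
    show "U \<subseteq> U + U"
      using subspace_0[OF U] by (force simp: set_plus_def)
  qed
  then show ?thesis
    by (simp add: quotient_module_def set_plus_rearrange)
qed

lemma abelian_group_quotient_module: "abelian_group (quotient_module sc U)"
proof (rule abelian_groupI)
  fix A assume "A \<in> carrier (quotient_module sc U)"
  then obtain a where A: "A = a +o U" by (auto simp: quotient_module_def)
  show "\<zero>\<^bsub>quotient_module sc U\<^esub> \<oplus>\<^bsub>quotient_module sc U\<^esub> A = A"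
    using quotient_module_add[of 0 a] by (simp add: A quotient_module_def)
  show "\<exists>B\<in>carrier (quotient_module sc U). B \<oplus>\<^bsub>quotient_module sc U\<^esub> A = \<zero>\<^bsub>quotient_module sc U\<^esub>"
    using quotient_module_add[of "- a" a]
    by (intro bexI[of _ "(- a) +o U"]) (auto simp: A quotient_module_def)
next
  fix A B assume "A \<in> carrier (quotient_module sc U)" "B \<in> carrier (quotient_module sc U)"
  then obtain a b where "A = a +o U" "B = b +o U" by (auto simp: quotient_module_def)
  then show "A \<oplus>\<^bsub>quotient_module sc U\<^esub> B \<in> carrier (quotient_module sc U)"
    using quotient_module_add[of a b] by (simp add: quotient_module_def)
next
  show "\<zero>\<^bsub>quotient_module sc U\<^esub> \<in> carrier (quotient_module sc U)"
    by (auto simp: quotient_module_def intro: range_eqI[of _ _ 0])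
qed (simp_all add: quotient_module_def ac_simps)

lemma Union_cosets:
  assumes "\<And>a. a - w \<in> U \<Longrightarrow> g a - g w \<in> U"
  shows "(\<Union>a\<in>w +o U. g a +o U) = g w +o U"
proof -
  have "g a +o U = g w +o U" if "a \<in> w +o U" for a
    unfolding coset_eq_iff using that by (intro assms) (auto simp: elt_set_plus_def)
  moreover have "w \<in> w +o U"
    using subspace_0[OF U] by (force simp: elt_set_plus_def)
  ultimately show ?thesis by blast
qed

lemma quotient_module_smult:
  "c \<odot>\<^bsub>quotient_module sc U\<^esub> (w +o U) = sc c w +o U"
  unfolding quotient_module_def
  by (simp, rule Union_cosets) (metis U subspace_scale scale_right_diff_distrib)

lemma quotient_action_coset:
  assumes "lie_algebra sc \<nu>" and "lie_subalgebra sc \<nu> U" and "f x \<in> U"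
  shows "quotient_action \<nu> f U x (w +o U) = \<nu> (f x) w +o U"
  unfolding quotient_action_def
proof (rule Union_cosets)
  fix a assume "a - w \<in> U"
  then have "\<nu> (f x) (a - w) \<in> U"
    using assms by (auto simp: lie_subalgebra_def)
  then show "\<nu> (f x) a - \<nu> (f x) w \<in> U"
    using lie_algebra.linear_right[OF assms(1), of "f x"]
    by (metis Vector_Spaces.linear_iff_module_hom module_hom.diff)
qed

end


section \<open>Chevalley--Eilenberg cohomology\<close>

text \<open>
  An \<open>n\<close>-cochain is an alternating \<open>n\<close>-linear map, taking its arguments as a list of
  length \<open>n\<close> (and extensional, i.e. \<open>undefined\<close>, on lists of other lengths).
\<close>

definition ce_cochains ::
  "('k::field \<Rightarrow> 'a::ab_group_add \<Rightarrow> 'a) \<Rightarrow> ('k, 'm) module \<Rightarrow> nat \<Rightarrow> ('a list \<Rightarrow> 'm) set" where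
  "ce_cochains sc M n =
     {\<omega> \<in> {xs. length xs = n} \<rightarrow>\<^sub>E carrier M.
        (\<forall>xs i x y. length xs = n \<and> i < n \<longrightarrow>
           \<omega> (xs[i := x + y]) = \<omega> (xs[i := x]) \<oplus>\<^bsub>M\<^esub> \<omega> (xs[i := y])) \<and>
        (\<forall>xs i c x. length xs = n \<and> i < n \<longrightarrow>
           \<omega> (xs[i := sc c x]) = c \<odot>\<^bsub>M\<^esub> \<omega> (xs[i := x])) \<and>
        (\<forall>xs i j. length xs = n \<and> i < j \<and> j < n \<and> xs ! i = xs ! j \<longrightarrow> \<omega> xs = \<zero>\<^bsub>M\<^esub>)}"

text \<open>
  The standard differential
  \[ (d\omega)(x_0,\dots,x_n) = \sum_{i} (-1)^i x_i \cdot \omega(\dots,\hat x_i,\dots)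
     + \sum_{i<j} (-1)^{i+j} \omega([x_i,x_j],\dots,\hat x_i,\dots,\hat x_j,\dots). \]
\<close>

definition ce_differential ::
  "('a \<Rightarrow> 'a \<Rightarrow> 'a) \<Rightarrow> ('k::field, 'm) module \<Rightarrow> ('a \<Rightarrow> 'm \<Rightarrow> 'm) \<Rightarrow> nat \<Rightarrow>
   ('a list \<Rightarrow> 'm) \<Rightarrow> 'a list \<Rightarrow> 'm" where
  "ce_differential \<mu> M act n \<omega> =
     (\<lambda>xs\<in>{xs. length xs = Suc n}.
        (\<Oplus>\<^bsub>M\<^esub>i\<in>{..n}. ((-1) ^ i) \<odot>\<^bsub>M\<^esub> act (xs ! i) (\<omega> (nths xs (- {i})))) \<oplus>\<^bsub>M\<^esub>
        (\<Oplus>\<^bsub>M\<^esub>p\<in>{(i, j). i < j \<and> j \<le> n}.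
           ((-1) ^ (fst p + snd p)) \<odot>\<^bsub>M\<^esub>
             \<omega> (\<mu> (xs ! fst p) (xs ! snd p) # nths xs (- {fst p, snd p}))))"

definition ce_cocycles ::
  "('k::field \<Rightarrow> 'a::ab_group_add \<Rightarrow> 'a) \<Rightarrow> ('a \<Rightarrow> 'a \<Rightarrow> 'a) \<Rightarrow> ('k, 'm) module \<Rightarrow> ('a \<Rightarrow> 'm \<Rightarrow> 'm) \<Rightarrow>
   nat \<Rightarrow> ('a list \<Rightarrow> 'm) set" where
  "ce_cocycles sc \<mu> M act n =
     {\<omega> \<in> ce_cochains sc M n.
        ce_differential \<mu> M act n \<omega> = (\<lambda>xs\<in>{xs. length xs = Suc n}. \<zero>\<^bsub>M\<^esub>)}"

fun ce_coboundaries ::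
  "('k::field \<Rightarrow> 'a::ab_group_add \<Rightarrow> 'a) \<Rightarrow> ('a \<Rightarrow> 'a \<Rightarrow> 'a) \<Rightarrow> ('k, 'm) module \<Rightarrow> ('a \<Rightarrow> 'm \<Rightarrow> 'm) \<Rightarrow>
   nat \<Rightarrow> ('a list \<Rightarrow> 'm) set" where
  "ce_coboundaries sc \<mu> M act 0 = {\<lambda>xs\<in>{xs. length xs = 0}. \<zero>\<^bsub>M\<^esub>}"
| "ce_coboundaries sc \<mu> M act (Suc n) = ce_differential \<mu> M act n ` ce_cochains sc M n"

text \<open>
  The quotient of cocycles by coboundaries, as the set of cosets.  It vanishes iff the coset of
  the zero cocycle, i.e. the set of coboundaries, is its only element.
\<close>

definition ce_cohomology ::
  "('k::field \<Rightarrow> 'a::ab_group_add \<Rightarrow> 'a) \<Rightarrow> ('a \<Rightarrow> 'a \<Rightarrow> 'a) \<Rightarrow> ('k, 'm) module \<Rightarrow> ('a \<Rightarrow> 'm \<Rightarrow> 'm) \<Rightarrow>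
   nat \<Rightarrow> ('a list \<Rightarrow> 'm) set set" where
  "ce_cohomology sc \<mu> M act n =
     (\<lambda>\<alpha>. (\<lambda>\<beta>. \<lambda>xs\<in>{xs. length xs = n}. \<alpha> xs \<oplus>\<^bsub>M\<^esub> \<beta> xs) ` ce_coboundaries sc \<mu> M act n) `
       ce_cocycles sc \<mu> M act n"

definition ce_cohomology_vanishes ::
  "('k::field \<Rightarrow> 'a::ab_group_add \<Rightarrow> 'a) \<Rightarrow> ('a \<Rightarrow> 'a \<Rightarrow> 'a) \<Rightarrow> ('k, 'm) module \<Rightarrow> ('a \<Rightarrow> 'm \<Rightarrow> 'm) \<Rightarrow>
   nat \<Rightarrow> bool" where
  "ce_cohomology_vanishes sc \<mu> M act n \<longleftrightarrow>
     ce_cohomology sc \<mu> M act n = {ce_coboundaries sc \<mu> M act n}"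

end

theory Submission
  imports Defs "HOL-Library.Function_Algebras"
begin

text \<open>
  The idea.  Conjugate a nearby morphism \<open>f'\<close> by \<open>exp (ad (- w))\<close>, with \<open>w\<close> small and to be chosen,
  and look at what is left modulo \<open>U\<close>: the \<open>1\<close>-cochain \<open>c = q \<circ> exp (ad (- w)) \<circ> f'\<close>, where \<open>q\<close> is a
  projection of \<open>W\<close> with kernel \<open>U\<close> that plays the role of \<open>W \<rightarrow> W/U\<close>.  One wants \<open>c = 0\<close>, for then
  \<open>f'\<close> takes its values in \<open>exp (ad w) U\<close>.  This is a nonlinear equation whose behaviour near
  \<open>f' = f\<close> and \<open>w = 0\<close> is governed by the Chevalley-Eilenberg complex \<open>W \<rightarrow> Hom(V, W/U) \<rightarrow> Hom(V \<otimes> V, W/U)\<close> of \<open>f\<close>.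

  Exactness in the middle is used through a partial contracting homotopy: linear maps \<open>s\<close> and \<open>t\<close>
  with \<open>c = d0 (s c) + t (d1 c)\<close> for all \<open>1\<close>-cochains \<open>c\<close> (lemma \<open>homotopy\<close>).  It splits the equation
  \<open>c = 0\<close> into two halves.

  The half \<open>s c = 0\<close> is an equation for \<open>w\<close> whose derivative in \<open>w\<close> is invertible on the range of \<open>s\<close>,
  so that it can be solved by a contraction (lemma \<open>normalizing_conjugation\<close>).  The analytic input is
  that \<open>w \<mapsto> exp (ad (- w))\<close> is strictly differentiable at \<open>0\<close> (lemma \<open>exp_neg_ad_strictly_differentiable\<close>).

  The other half, \<open>d1 c = 0\<close>, need not be solved: because \<open>exp (ad (- w)) \<circ> f'\<close> is again a morphism, and is
  close to \<open>f\<close>, the value \<open>d1 c\<close> is at most a small multiple of \<open>c\<close>.  Once \<open>s c = 0\<close>, this gives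
  \<open>\<bar>c\<bar> = \<bar>t (d1 c)\<bar> \<le> \<bar>c\<bar> / 2\<close>, hence \<open>c = 0\<close> (lemma \<open>close_normalized_hom_into_U\<close>).

  The element \<open>w\<close> found in this way depends only on \<open>f'\<close>, so that the constant map with value \<open>w\<close>, on the whole
  of \<open>{[w] \<in> W/U | \<nu>(w, f(V)) \<subseteq> U}\<close>, is a family as required.
\<close>

section \<open>Linear maps and completeness of the ground field\<close>

lemmas lin_add = module_hom.add[OF module_hom_linearI]
lemmas lin_diff = module_hom.diff[OF module_hom_linearI]
lemmas lin_neg = module_hom.neg[OF module_hom_linearI]
lemmas lin_zero = module_hom.zero[OF module_hom_linearI]
lemmas lin_scale = module_hom.scale[OF module_hom_linearI]
lemmas lin_sum = module_hom.sum[OF module_hom_linearI]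

text \<open>
  The embedding into the complex numbers is isometric with closed range, so completeness is inherited.
\<close>

instance real_or_complex \<subseteq> banach
proof
  fix X :: "nat \<Rightarrow> 'a"
  assume X: "Cauchy X"
  obtain h :: "'a \<Rightarrow> complex" where
    h_add: "\<And>x y. h (x + y) = h x + h y" and h_norm: "\<And>x. norm (h x) = norm x"
    and h_range: "range h = \<real> \<or> range h = UNIV"
    using ex_embedding_complex[where 'a='a] by blast
  have h_diff: "h (x - y) = h x - h y" for x y
    using h_add[of "x - y" y] by simp
  have h_dist: "dist (h x) (h y) = dist x y" for x y
    by (simp add: dist_norm h_norm flip: h_diff)
  have "Cauchy (\<lambda>n. h (X n))"
    using X by (simp add: Cauchy_def h_dist)
  then obtain L where L: "(\<lambda>n. h (X n)) \<longlonglongrightarrow> L"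
    by (auto simp: Cauchy_convergent_iff convergent_def)
  have "closed (range h)"
    using h_range closed_complex_Reals by auto
  then have "L \<in> range h"
    using L closed_sequentially[of "range h" "\<lambda>n. h (X n)" L] by simp
  then obtain l where "L = h l"
    by blast
  then have "X \<longlonglongrightarrow> l"
    using L by (simp add: tendsto_iff h_dist)
  then show "convergent X"
    by (rule convergentI)
qed

section \<open>Norm and convergence in coordinates\<close>

text \<open>
  The analysis takes place on a finite-dimensional space whose type carries no norm.  The sum of the absolute
  values of the coordinates in the given basis is used instead.
\<close>

locale fd_space = finite_dimensional_vector_space scale Basis
  for scale :: "'k::real_or_complex \<Rightarrow> 'a::ab_group_add \<Rightarrow> 'a" and Basis :: "'a set"
begin

abbreviation coord :: "'a \<Rightarrow> 'a \<Rightarrow> 'k" where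
  "coord b x \<equiv> representation Basis x b"

abbreviation functional :: "('a \<Rightarrow> 'k) \<Rightarrow> bool" where
  "functional \<phi> \<equiv> Vector_Spaces.linear scale (*) \<phi>"

definition vnorm :: "'a \<Rightarrow> real" where
  "vnorm x = (\<Sum>b\<in>Basis. norm (coord b x))"

text \<open>
  Convergence of a series is tested by linear functionals.  In finite dimension this is convergence in norm,
  and it is literally the kind of convergence that defines \<open>fd_topology\<close>.
\<close>

definition vsums :: "(nat \<Rightarrow> 'a) \<Rightarrow> 'a \<Rightarrow> bool" where
  "vsums z y \<longleftrightarrow> (\<forall>\<phi>. functional \<phi> \<longrightarrow> (\<lambda>k. \<phi> (z k)) sums \<phi> y)"

lemma functional_coord: "functional (coord b)"
  using linear_representation[OF independent_Basis span_Basis] .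

lemma coord_expansion: "x = (\<Sum>b\<in>Basis. scale (coord b x) b)"
  using sum_representation_eq[OF independent_Basis _ finite_Basis subset_refl, of x] span_Basis by simp

lemma linear_coord_expansion:
  assumes "Vector_Spaces.linear scale s2 L"
  shows "L x = (\<Sum>b\<in>Basis. s2 (coord b x) (L b))"
  by (subst coord_expansion[of x]) (simp add: lin_sum[OF assms] lin_scale[OF assms])

lemma vnorm_nonneg [simp]: "0 \<le> vnorm x"
  by (simp add: vnorm_def sum_nonneg)

lemma norm_coord_le: "b \<in> Basis \<Longrightarrow> norm (coord b x) \<le> vnorm x"
  unfolding vnorm_def by (rule member_le_sum) (auto simp: finite_Basis)

lemma vnorm_zero [simp]: "vnorm 0 = 0"
  by (simp add: vnorm_def lin_zero[OF functional_coord])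

lemma vnorm_eq_0_iff [simp]: "vnorm x = 0 \<longleftrightarrow> x = 0"
proof
  assume "vnorm x = 0"
  then have "\<forall>b\<in>Basis. coord b x = 0"
    by (simp add: vnorm_def sum_nonneg_eq_0_iff finite_Basis)
  then show "x = 0"
    by (subst coord_expansion) simp
qed simp

lemma vnorm_scale: "vnorm (scale c x) = norm c * vnorm x"
  by (simp add: vnorm_def lin_scale[OF functional_coord] norm_mult sum_distrib_left)

lemma vnorm_minus [simp]: "vnorm (- x) = vnorm x"
  by (simp add: vnorm_def lin_neg[OF functional_coord])

lemma vnorm_minus_commute: "vnorm (x - y) = vnorm (y - x)"
  by (metis minus_diff_eq vnorm_minus)

lemma vnorm_triangle: "vnorm (x + y) \<le> vnorm x + vnorm y"
  unfolding vnorm_def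
  by (simp add: lin_add[OF functional_coord] norm_triangle_ineq sum_mono flip: sum.distrib)

lemma vnorm_triangle_diff: "vnorm (x - y) \<le> vnorm x + vnorm y"
  using vnorm_triangle[of x "- y"] by simp

lemma vnorm_sum: "vnorm (sum g I) \<le> (\<Sum>i\<in>I. vnorm (g i))"
  by (induction I rule: infinite_finite_induct) (auto intro: order_trans[OF vnorm_triangle])

text \<open>
  The one source of boundedness of linear maps: the domain may be any vector space, such as a space of functions,
  as long as only combinations of finitely many fixed vectors are considered.
\<close>

lemma linear_bounded_on_combinations:
  assumes "Vector_Spaces.linear s1 scale L"
  shows "\<exists>C\<ge>0. \<forall>a. vnorm (L (\<Sum>i\<in>I. s1 (a i) (x i))) \<le> C * (\<Sum>i\<in>I. norm (a i))"
proof (cases "finite I")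
  case True
  let ?C = "\<Sum>i\<in>I. vnorm (L (x i))"
  have "vnorm (L (\<Sum>i\<in>I. s1 (a i) (x i))) \<le> ?C * (\<Sum>i\<in>I. norm (a i))" for a
  proof -
    have "vnorm (L (\<Sum>i\<in>I. s1 (a i) (x i))) \<le> (\<Sum>i\<in>I. norm (a i) * vnorm (L (x i)))"
      using vnorm_sum[of "\<lambda>i. scale (a i) (L (x i))" I]
      by (simp add: lin_sum[OF assms] lin_scale[OF assms] vnorm_scale)
    also have "\<dots> \<le> (\<Sum>i\<in>I. norm (a i) * ?C)"
      by (intro sum_mono mult_left_mono member_le_sum) (auto simp: True)
    finally show ?thesis
      by (simp add: sum_distrib_right mult.commute)
  qed
  moreover have "0 \<le> ?C"
    by (simp add: sum_nonneg)
  ultimately show ?thesis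
    by blast
qed (auto simp: lin_zero[OF assms])

lemma linear_bounded:
  assumes "Vector_Spaces.linear scale scale T"
  shows "\<exists>C\<ge>0. \<forall>x. vnorm (T x) \<le> C * vnorm x"
proof -
  obtain C where C: "C \<ge> 0" "\<And>a. vnorm (T (\<Sum>b\<in>Basis. scale (a b) b)) \<le> C * (\<Sum>b\<in>Basis. norm (a b))"
    using linear_bounded_on_combinations[OF assms, where I=Basis and x="\<lambda>b. b"] by blast
  have "vnorm (T x) \<le> C * vnorm x" for x
    using C(2)[of "\<lambda>b. coord b x"] by (simp add: vnorm_def flip: coord_expansion)
  with C(1) show ?thesis
    by blast
qed

lemma bilinear_bounded:
  assumes L: "\<And>y. Vector_Spaces.linear scale scale (\<lambda>x. \<beta> x y)"
    and R: "\<And>x. Vector_Spaces.linear scale scale (\<beta> x)"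
  shows "\<exists>K\<ge>0. \<forall>x y. vnorm (\<beta> x y) \<le> K * vnorm x * vnorm y"
proof -
  have "\<exists>C. 0 \<le> C \<and> (\<forall>y. vnorm (\<beta> x y) \<le> C * vnorm y)" for x
    using linear_bounded[OF R] by blast
  then obtain C where C0: "\<And>x. 0 \<le> C x" and C: "\<And>x y. vnorm (\<beta> x y) \<le> C x * vnorm y"
    by metis
  let ?K = "\<Sum>b\<in>Basis. C b"
  have "vnorm (\<beta> x y) \<le> ?K * vnorm x * vnorm y" for x y
  proof -
    have "vnorm (\<beta> x y) \<le> (\<Sum>b\<in>Basis. norm (coord b x) * vnorm (\<beta> b y))"
      using vnorm_sum[of "\<lambda>b. scale (coord b x) (\<beta> b y)" Basis]
      by (subst linear_coord_expansion[OF L]) (simp add: vnorm_scale)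
    also have "\<dots> \<le> (\<Sum>b\<in>Basis. vnorm x * (C b * vnorm y))"
      by (intro sum_mono mult_mono norm_coord_le C) auto
    finally show ?thesis
      by (simp add: sum_distrib_left sum_distrib_right mult_ac)
  qed
  moreover have "0 \<le> ?K"
    using C0 by (simp add: sum_nonneg)
  ultimately show ?thesis
    by blast
qed

lemma functional_bounded:
  assumes "functional \<phi>"
  shows "\<exists>C\<ge>0. \<forall>x. norm (\<phi> x) \<le> C * vnorm x"
proof -
  let ?C = "\<Sum>b\<in>Basis. norm (\<phi> b)"
  have "norm (\<phi> x) \<le> ?C * vnorm x" for x
  proof -
    have "norm (\<phi> x) \<le> (\<Sum>b\<in>Basis. norm (coord b x) * norm (\<phi> b))"
      by (subst linear_coord_expansion[OF assms]) (rule order_trans[OF norm_sum], simp add: norm_mult)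
    also have "\<dots> \<le> (\<Sum>b\<in>Basis. vnorm x * norm (\<phi> b))"
      by (intro sum_mono mult_right_mono norm_coord_le) auto
    finally show ?thesis
      by (simp add: sum_distrib_left mult.commute)
  qed
  moreover have "0 \<le> ?C"
    by (simp add: sum_nonneg)
  ultimately show ?thesis
    by blast
qed

lemma vsumsI:
  assumes "\<And>b. b \<in> Basis \<Longrightarrow> (\<lambda>k. coord b (z k)) sums coord b y"
  shows "vsums z y"
  unfolding vsums_def
proof (intro allI impI)
  fix \<phi> assume \<phi>: "functional \<phi>"
  have "(\<lambda>k. \<Sum>b\<in>Basis. coord b (z k) * \<phi> b) sums (\<Sum>b\<in>Basis. coord b y * \<phi> b)"
    by (intro sums_sum sums_mult2 assms)
  then show "(\<lambda>k. \<phi> (z k)) sums \<phi> y"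
    by (simp add: linear_coord_expansion[OF \<phi>, symmetric])
qed

lemma vsumsD: "vsums z y \<Longrightarrow> functional \<phi> \<Longrightarrow> (\<lambda>k. \<phi> (z k)) sums \<phi> y"
  by (simp add: vsums_def)

lemma functional_separates:
  assumes "\<And>\<phi>. functional \<phi> \<Longrightarrow> \<phi> x = \<phi> y"
  shows "x = y"
  by (subst (1 2) coord_expansion) (simp add: assms[OF functional_coord])

lemma vsums_unique: "vsums z x \<Longrightarrow> vsums z y \<Longrightarrow> x = y"
  by (rule functional_separates) (metis vsumsD sums_unique2)

text \<open>
  The form in which completeness is used, both for the exponential series and for the iteration of a contraction.
\<close>

lemma absolutely_summable_vsums:
  assumes "summable g" "\<And>k. vnorm (z k) \<le> g k"
  shows "\<exists>y. vsums z y"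
proof -
  have S: "summable (\<lambda>k. coord b (z k))" if "b \<in> Basis" for b
    using assms(1) by (rule summable_comparison_test'[where N=0])
      (rule order_trans[OF norm_coord_le[OF that] assms(2)])
  let ?y = "\<Sum>b\<in>Basis. scale (\<Sum>k. coord b (z k)) b"
  have "coord c ?y = (\<Sum>k. coord c (z k))" if "c \<in> Basis" for c
  proof -
    have "coord c ?y = (\<Sum>b\<in>Basis. (\<Sum>k. coord b (z k)) * coord c b)"
      by (simp add: lin_sum[OF functional_coord] lin_scale[OF functional_coord])
    also have "\<dots> = (\<Sum>b\<in>Basis. if b = c then (\<Sum>k. coord c (z k)) else 0)"
      by (rule sum.cong) (auto simp: representation_basis independent_Basis)
    finally show ?thesis
      using that by (simp add: finite_Basis)
  qed
  then have "vsums z ?y"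
    using S by (intro vsumsI) (simp add: summable_sums)
  then show ?thesis ..
qed

lemma vnorm_vsums_le:
  assumes "vsums z y" "summable g" "\<And>k. vnorm (z k) \<le> g k"
  shows "vnorm y \<le> suminf g"
proof -
  have S: "summable (\<lambda>k. norm (coord b (z k)))" if "b \<in> Basis" for b
    using assms(2) by (rule summable_comparison_test'[where N=0])
      (simp add: order_trans[OF norm_coord_le[OF that] assms(3)])
  have "norm (coord b y) \<le> (\<Sum>k. norm (coord b (z k)))" if "b \<in> Basis" for b
    using vsumsD[OF assms(1) functional_coord, of b] summable_norm[OF S[OF that]]
    by (simp add: sums_iff)
  then have "vnorm y \<le> (\<Sum>b\<in>Basis. \<Sum>k. norm (coord b (z k)))"
    unfolding vnorm_def by (rule sum_mono)
  also have "\<dots> = (\<Sum>k. vnorm (z k))"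
    unfolding vnorm_def using S by (rule suminf_sum[symmetric])
  also have "\<dots> \<le> suminf g"
    using assms(2,3) unfolding vnorm_def
    by (intro suminf_le summable_sum S) auto
  finally show ?thesis .
qed

text \<open>
  The Cauchy product for the pairing of a series of functionals with a series of vectors.  In coordinates it is
  a finite sum of Cauchy products of series of scalars.  It yields both that \<open>exp (- T)\<close> is an inverse of
  \<open>exp T\<close> and that the exponential of a derivation is an automorphism.
\<close>

lemma Cauchy_product_functionals:
  assumes z: "vsums z x" "summable g" "\<And>k. vnorm (z k) \<le> g k"
    and \<psi>: "\<And>k. functional (\<psi> k)" "functional \<Psi>"
    and abs: "\<And>y. summable (\<lambda>k. norm (\<psi> k y))"
    and conv: "\<And>y. (\<lambda>k. \<psi> k y) sums \<Psi> y"
  shows "(\<lambda>n. \<Sum>i\<le>n. \<psi> i (z (n - i))) sums \<Psi> x"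
proof -
  have "(\<lambda>n. \<Sum>i\<le>n. \<psi> i b * coord b (z (n - i))) sums (\<Psi> b * coord b x)" if b: "b \<in> Basis" for b
  proof -
    have "summable (\<lambda>k. norm (coord b (z k)))"
      using z(2) by (rule summable_comparison_test'[where N=0])
        (simp add: order_trans[OF norm_coord_le[OF b] z(3)])
    from Cauchy_product_sums[OF abs this] show ?thesis
      using conv[of b] vsumsD[OF z(1) functional_coord, of b] by (simp add: sums_iff)
  qed
  then have "(\<lambda>n. \<Sum>b\<in>Basis. \<Sum>i\<le>n. \<psi> i b * coord b (z (n - i))) sums (\<Sum>b\<in>Basis. \<Psi> b * coord b x)"
    by (intro sums_sum)
  moreover have "(\<Sum>b\<in>Basis. \<Psi> b * coord b x) = \<Psi> x"
    by (subst linear_coord_expansion[OF \<psi>(2), of x]) (simp add: mult.commute)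
  moreover have "(\<Sum>b\<in>Basis. \<Sum>i\<le>n. \<psi> i b * coord b (z (n - i))) = (\<Sum>i\<le>n. \<psi> i (z (n - i)))" for n
    by (subst sum.swap) (simp add: linear_coord_expansion[OF \<psi>(1), where x="z _"] mult.commute)
  ultimately show ?thesis
    by simp
qed

lemma topspace_fd_topology [simp]: "topspace (fd_topology scale) = UNIV"
proof -
  have "functional (\<lambda>_. 0)"
    by (simp add: Vector_Spaces.linear_iff vector_space_axioms vector_space_def algebra_simps)
  then have "(\<lambda>_. 0) -` UNIV \<in> {\<phi> -` S | \<phi> S. functional \<phi> \<and> open S}"
    by blast
  then show ?thesis
    unfolding fd_topology_def topology_generated_by_topspace by auto
qed

lemma openin_functional_vimage:
  assumes "functional \<phi>" "open S"
  shows "openin (fd_topology scale) (\<phi> -` S)"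
  unfolding fd_topology_def using assms by (intro topology_generated_by_Basis) blast

lemma limitin_fd_topology:
  "limitin (fd_topology scale) F y sequentially \<longleftrightarrow>
     (\<forall>\<phi>. functional \<phi> \<longrightarrow> (\<lambda>n. \<phi> (F n)) \<longlonglongrightarrow> \<phi> y)"
proof (intro iffI allI impI)
  fix \<phi> assume lim: "limitin (fd_topology scale) F y sequentially" and \<phi>: "functional \<phi>"
  show "(\<lambda>n. \<phi> (F n)) \<longlonglongrightarrow> \<phi> y"
  proof (rule topological_tendstoI)
    fix S assume "open S" "\<phi> y \<in> S"
    with lim openin_functional_vimage[OF \<phi>, of S]
    show "\<forall>\<^sub>F n in sequentially. \<phi> (F n) \<in> S"
      by (auto simp: limitin_def)
  qed
next
  assume lim: "\<forall>\<phi>. functional \<phi> \<longrightarrow> (\<lambda>n. \<phi> (F n)) \<longlonglongrightarrow> \<phi> y"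
  have "\<forall>\<^sub>F n in sequentially. F n \<in> S"
    if "generate_topology_on {\<phi> -` S | \<phi> S. functional \<phi> \<and> open S} S" "y \<in> S" for S
    using that
  proof induction
    case (Int a b)
    then show ?case by (auto intro: eventually_conj)
  next
    case (UN K)
    then obtain k where "k \<in> K" "\<forall>\<^sub>F n in sequentially. F n \<in> k"
      by blast
    then show ?case by (auto elim: eventually_mono)
  next
    case (Basis s)
    then show ?case using lim by (auto simp: tendsto_def)
  qed simp
  then show "limitin (fd_topology scale) F y sequentially"
    by (simp add: limitin_def) (simp add: fd_topology_def openin_topology_generated_by_iff)
qed

section \<open>The exponential of an endomorphism\<close>

lemma vnorm_power_le:
  assumes T: "\<And>x. vnorm (T x) \<le> a * vnorm x" and "0 \<le> a"
  shows "vnorm ((T ^^ k) x) \<le> a ^ k * vnorm x"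
proof (induction k)
  case (Suc k)
  have "vnorm ((T ^^ Suc k) x) \<le> a * vnorm ((T ^^ k) x)"
    using T by simp
  also have "\<dots> \<le> a * (a ^ k * vnorm x)"
    using Suc \<open>0 \<le> a\<close> by (rule mult_left_mono)
  finally show ?case by (simp add: mult_ac)
qed simp

lemma exp_term_bound:
  assumes "\<And>x. vnorm (T x) \<le> a * vnorm x" and "0 \<le> a"
  shows "vnorm (scale (inverse (fact k)) ((T ^^ k) x)) \<le> inverse (fact k) * a ^ k * vnorm x"
  using vnorm_power_le[of T a k x] assms
  by (simp add: vnorm_scale norm_inverse mult.assoc mult_left_mono)

lemma summable_exp_bound: "summable (\<lambda>k. inverse (fact k) * a ^ k * c :: real)"
  using summable_mult2[OF summable_exp[of a]] by simp

lemma vsums_exp_end: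
  assumes "Vector_Spaces.linear scale scale T"
  shows "vsums (\<lambda>k. scale (inverse (fact k)) ((T ^^ k) x)) (exp_end scale T x)"
proof -
  obtain a where a: "0 \<le> a" "\<And>x. vnorm (T x) \<le> a * vnorm x"
    using linear_bounded[OF assms] by blast
  let ?z = "\<lambda>k. scale (inverse (fact k)) ((T ^^ k) x)"
  have "\<exists>y. vsums ?z y"
    using exp_term_bound[OF a(2,1)]
    by (intro absolutely_summable_vsums[OF summable_exp_bound]) auto
  then obtain y where y: "vsums ?z y" ..
  have lim_iff: "limitin (fd_topology scale) (\<lambda>n. \<Sum>k<n. ?z k) y' sequentially \<longleftrightarrow> vsums ?z y'" for y'
    unfolding limitin_fd_topology vsums_def sums_def by (simp add: lin_sum cong: imp_cong)
  have "exp_end scale T x = y"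
    unfolding exp_end_def lim_iff using y by (blast intro: the_equality vsums_unique)
  then show ?thesis
    using y by simp
qed

lemma linear_power:
  assumes "Vector_Spaces.linear scale scale T"
  shows "Vector_Spaces.linear scale scale (T ^^ k)"
proof (induction k)
  case (Suc k)
  then show ?case
    unfolding funpow.simps by (rule Vector_Spaces.linear_compose[OF _ assms])
qed (simp add: linear_ident)

lemma linear_exp_end:
  assumes T: "Vector_Spaces.linear scale scale T"
  shows "Vector_Spaces.linear scale scale (exp_end scale T)"
proof -
  note lin = lin_add[OF linear_power[OF T]] lin_scale[OF linear_power[OF T]]
  have "exp_end scale T (x + y) = exp_end scale T x + exp_end scale T y" for x y
  proof (rule vsums_unique[OF vsums_exp_end[OF T]])
    show "vsums (\<lambda>k. scale (inverse (fact k)) ((T ^^ k) (x + y))) (exp_end scale T x + exp_end scale T y)"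
      unfolding vsums_def
    proof (intro allI impI)
      fix \<phi> assume \<phi>: "functional \<phi>"
      show "(\<lambda>k. \<phi> (scale (inverse (fact k)) ((T ^^ k) (x + y)))) sums \<phi> (exp_end scale T x + exp_end scale T y)"
        using sums_add[OF vsumsD[OF vsums_exp_end[OF T, of x] \<phi>] vsumsD[OF vsums_exp_end[OF T, of y] \<phi>]]
        by (simp add: lin scale_right_distrib lin_add[OF \<phi>])
    qed
  qed
  moreover have "exp_end scale T (scale c x) = scale c (exp_end scale T x)" for c x
  proof (rule vsums_unique[OF vsums_exp_end[OF T]])
    show "vsums (\<lambda>k. scale (inverse (fact k)) ((T ^^ k) (scale c x))) (scale c (exp_end scale T x))"
      unfolding vsums_def
    proof (intro allI impI)
      fix \<phi> assume \<phi>: "functional \<phi>"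
      show "(\<lambda>k. \<phi> (scale (inverse (fact k)) ((T ^^ k) (scale c x)))) sums \<phi> (scale c (exp_end scale T x))"
        using sums_mult[OF vsumsD[OF vsums_exp_end[OF T, of x] \<phi>], of c]
        by (simp add: lin lin_scale[OF \<phi>] mult_ac)
    qed
  qed
  ultimately show ?thesis
    by (simp add: Vector_Spaces.linear_iff vector_space_axioms)
qed

text \<open>
  Induction on the telescoping identity \<open>S^(k+1) - T^(k+1) = (S - T) S^k + T (S^k - T^k)\<close>.
\<close>

lemma vnorm_power_diff_le:
  assumes T: "Vector_Spaces.linear scale scale T"
    and bound: "\<And>x. vnorm (S x) \<le> a * vnorm x" "\<And>x. vnorm (T x) \<le> a * vnorm x" "0 \<le> a"
    and diff: "\<And>x. vnorm (S x - T x) \<le> d * vnorm x" "0 \<le> d"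
  shows "vnorm ((S ^^ Suc k) x - (T ^^ Suc k) x) \<le> real (Suc k) * a ^ k * d * vnorm x"
proof (induction k)
  case (Suc k)
  let ?s = "(S ^^ Suc k) x" and ?t = "(T ^^ Suc k) x"
  have "vnorm ((S ^^ Suc (Suc k)) x - (T ^^ Suc (Suc k)) x) = vnorm ((S ?s - T ?s) + T (?s - ?t))"
    by (simp add: lin_diff[OF T])
  also have "\<dots> \<le> vnorm (S ?s - T ?s) + vnorm (T (?s - ?t))"
    by (rule vnorm_triangle)
  also have "\<dots> \<le> d * vnorm ?s + a * vnorm (?s - ?t)"
    by (intro add_mono diff bound)
  also have "\<dots> \<le> d * (a ^ Suc k * vnorm x) + a * (real (Suc k) * a ^ k * d * vnorm x)"
    by (intro add_mono mult_left_mono vnorm_power_le Suc diff bound)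
  finally show ?case
    by (simp add: algebra_simps)
qed (simp add: diff)

text \<open>
  A Lipschitz estimate for \<open>exp S - S\<close> in \<open>S\<close>.  The terms of order \<open>0\<close> and \<open>1\<close> of the series cancel, and the
  previous lemma bounds the term of order \<open>k\<close> by a multiple of \<open>a^(k-1) / (k-1)!\<close>.  Since \<open>exp a - 1\<close> is small
  when \<open>a\<close> is, the exponential is strictly differentiable at \<open>0\<close>.
\<close>

lemma exp_end_diff_bound:
  assumes S: "Vector_Spaces.linear scale scale S" and T: "Vector_Spaces.linear scale scale T"
    and bound: "\<And>x. vnorm (S x) \<le> a * vnorm x" "\<And>x. vnorm (T x) \<le> a * vnorm x" "0 \<le> a"
    and diff: "\<And>x. vnorm (S x - T x) \<le> d * vnorm x" "0 \<le> d"
  shows "vnorm (exp_end scale S x - exp_end scale T x - (S x - T x)) \<le> (exp a - 1) * d * vnorm x"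
proof -
  define z where "z k = scale (inverse (fact k)) ((S ^^ k) x) - scale (inverse (fact k)) ((T ^^ k) x)
      - (if k = 1 then S x - T x else 0)" for k :: nat
  \<comment> \<open>The dominating series is that of \<open>exp a - 1\<close>, shifted by one degree.\<close>
  define g where "g k = (if k \<le> 1 then 0 else inverse (fact (k - 1)) * a ^ (k - 1) * (d * vnorm x))" for k :: nat
  have "vsums z (exp_end scale S x - exp_end scale T x - (S x - T x))"
    unfolding vsums_def
  proof (intro allI impI)
    fix \<phi> assume \<phi>: "functional \<phi>"
    have "(\<lambda>k. if k = 1 then \<phi> (S x - T x) else 0) sums \<phi> (S x - T x)"
      by (rule sums_single)
    with sums_diff[OF vsumsD[OF vsums_exp_end[OF S, of x] \<phi>] vsumsD[OF vsums_exp_end[OF T, of x] \<phi>]]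
    have "(\<lambda>k. \<phi> (scale (inverse (fact k)) ((S ^^ k) x)) - \<phi> (scale (inverse (fact k)) ((T ^^ k) x))
        - (if k = 1 then \<phi> (S x - T x) else 0)) sums
        (\<phi> (exp_end scale S x) - \<phi> (exp_end scale T x) - \<phi> (S x - T x))"
      by (rule sums_diff)
    moreover have "\<phi> (z k) = \<phi> (scale (inverse (fact k)) ((S ^^ k) x)) - \<phi> (scale (inverse (fact k)) ((T ^^ k) x))
        - (if k = 1 then \<phi> (S x - T x) else 0)" for k
      by (simp add: z_def lin_diff[OF \<phi>] lin_zero[OF \<phi>])
    ultimately show "(\<lambda>k. \<phi> (z k)) sums \<phi> (exp_end scale S x - exp_end scale T x - (S x - T x))"
      by (simp add: lin_diff[OF \<phi>])
  qed
  moreover have g_sums: "g sums ((exp a - 1) * d * vnorm x)"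
  proof -
    have "(\<lambda>k. inverse (fact k) * a ^ k) sums exp a"
      using summable_sums[OF summable_exp[of a]] by (simp add: exp_def scaleR_conv_of_real divide_inverse mult.commute)
    then have "(\<lambda>k. inverse (fact k) * a ^ k - (if k = 0 then 1 else 0)) sums (exp a - 1)"
      by (rule sums_diff) (rule sums_single)
    from sums_mult2[OF this, of "d * vnorm x"]
    have "(\<lambda>k. g (Suc k)) sums ((exp a - 1) * (d * vnorm x))"
      by (rule sums_cong[THEN iffD1, rotated]) (auto simp: g_def)
    moreover have "g 0 = 0"
      by (simp add: g_def)
    ultimately show ?thesis
      using sums_Suc_iff[of g "(exp a - 1) * (d * vnorm x)"] by (simp add: mult.assoc)
  qed
  moreover have "vnorm (z k) \<le> g k" for k
  proof (cases "k \<le> 1")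
    case True
    then have "k = 0 \<or> k = 1" by auto
    then show ?thesis by (auto simp: z_def g_def)
  next
    case False
    then obtain j where k: "k = Suc j" "j \<noteq> 0" by (cases k) auto
    then have "z k = scale (inverse (fact k)) ((S ^^ k) x - (T ^^ k) x)"
      by (simp add: z_def scale_right_diff_distrib)
    then have "vnorm (z k) \<le> inverse (fact k) * (real k * a ^ j * d * vnorm x)"
      using vnorm_power_diff_le[OF T bound diff, of j x] k
      by (simp add: vnorm_scale norm_inverse mult_left_mono del: funpow.simps fact_Suc of_nat_Suc)
    also have "\<dots> = g k"
      using k by (simp add: g_def field_simps del: of_nat_Suc)
    finally show ?thesis .
  qed
  ultimately show ?thesis
    using vnorm_vsums_le[of z _ g] by (auto simp: sums_iff)
qed

text \<open>
  The Cauchy product of the two series has, in degree \<open>n\<close>, the alternating sum of the binomial coefficients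
  as its coefficient, and this vanishes for \<open>n > 0\<close>.
\<close>

lemma exp_end_minus_inverse:
  assumes T: "Vector_Spaces.linear scale scale T"
  shows "exp_end scale T (exp_end scale (\<lambda>x. - T x) x) = x"
proof -
  let ?N = "\<lambda>x. - T x"
  have N: "Vector_Spaces.linear scale scale ?N"
    using T by (simp add: Vector_Spaces.linear_iff)
  obtain a where a: "0 \<le> a" "\<And>x. vnorm (T x) \<le> a * vnorm x"
    using linear_bounded[OF T] by blast
  have aN: "vnorm (- T x) \<le> a * vnorm x" for x
    using a by simp
  have N_pow: "(?N ^^ k) x = scale ((-1) ^ k) ((T ^^ k) x)" for k
    by (induction k) (auto simp: lin_scale[OF T])
  show ?thesis
  proof (rule functional_separates)
    fix \<phi> assume \<phi>: "functional \<phi>"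
    define \<psi> where "\<psi> k y = \<phi> (scale (inverse (fact k)) ((T ^^ k) y))" for k y
    have \<psi>: "functional (\<psi> k)" for k
      using linear_power[OF T, of k] \<phi> by (simp add: Vector_Spaces.linear_iff \<psi>_def scale_right_distrib mult_ac)
    have "functional (\<lambda>y. \<phi> (exp_end scale T y))"
      using Vector_Spaces.linear_compose[OF linear_exp_end[OF T] \<phi>] by (simp add: comp_def)
    moreover have "summable (\<lambda>k. norm (\<psi> k y))" for y
    proof -
      obtain C where C: "C \<ge> 0" "\<And>x. norm (\<phi> x) \<le> C * vnorm x"
        using functional_bounded[OF \<phi>] by blast
      have "norm (norm (\<psi> k y)) \<le> C * (inverse (fact k) * a ^ k * vnorm y)" for k
        using order_trans[OF C(2) mult_left_mono[OF exp_term_bound[OF a(2,1)] C(1)]]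
        by (simp add: \<psi>_def)
      then show ?thesis
        by (intro summable_comparison_test'[OF summable_mult[OF summable_exp_bound]]) 
    qed
    moreover have "(\<lambda>k. \<psi> k y) sums \<phi> (exp_end scale T y)" for y
      unfolding \<psi>_def by (rule vsumsD[OF vsums_exp_end[OF T] \<phi>])
    ultimately have "(\<lambda>n. \<Sum>i\<le>n. \<psi> i (scale (inverse (fact (n - i))) ((?N ^^ (n - i)) x))) sums
        \<phi> (exp_end scale T (exp_end scale ?N x))"
      using \<psi> exp_term_bound[OF aN a(1)]
      by (intro Cauchy_product_functionals[OF vsums_exp_end[OF N] summable_exp_bound]) 
    moreover have "(\<Sum>i\<le>n. \<psi> i (scale (inverse (fact (n - i))) ((?N ^^ (n - i)) x))) = (if n = 0 then \<phi> x else 0)" for n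
    proof -
      have "(\<Sum>i\<le>n. \<psi> i (scale (inverse (fact (n - i))) ((?N ^^ (n - i)) x))) =
          (\<Sum>i\<le>n. (- 1) ^ (n - i) * of_nat (n choose (n - i)) * (inverse (fact n) * \<phi> ((T ^^ n) x)))"
      proof (rule sum.cong)
        fix i assume "i \<in> {..n}"
        then have i: "i \<le> n" by simp
        have c: "of_nat (n choose (n - i)) * inverse (fact n) = (inverse (fact i) * inverse (fact (n - i)) :: 'k)"
          using binomial_fact[of "n - i" n, where 'a='k] i by (simp add: field_simps)
        have "(T ^^ i) ((T ^^ (n - i)) x) = (T ^^ n) x"
          using i by (metis funpow_add comp_apply le_add_diff_inverse)
        then have "\<psi> i (scale (inverse (fact (n - i))) ((?N ^^ (n - i)) x)) =
           (- 1) ^ (n - i) * (inverse (fact i) * inverse (fact (n - i))) * \<phi> ((T ^^ n) x)"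
          unfolding \<psi>_def N_pow by (simp add: lin_scale[OF linear_power[OF T]] lin_scale[OF \<phi>])
        then show "\<psi> i (scale (inverse (fact (n - i))) ((?N ^^ (n - i)) x)) =
           (- 1) ^ (n - i) * of_nat (n choose (n - i)) * (inverse (fact n) * \<phi> ((T ^^ n) x))"
          by (simp add: mult.assoc flip: c)
      qed simp
      also have "\<dots> = (\<Sum>i\<le>n. (- 1) ^ i * of_nat (n choose i)) * (inverse (fact n) * \<phi> ((T ^^ n) x))"
        unfolding sum_distrib_right
        by (rule sum.reindex_bij_witness[of _ "\<lambda>i. n - i" "\<lambda>i. n - i"]) auto
      also have "\<dots> = (if n = 0 then \<phi> x else 0)"
        using choose_alternating_sum[of n, where 'a='k] by simp
      finally show ?thesis .
    qed
    ultimately have "(\<lambda>n. if n = 0 then \<phi> x else 0) sums \<phi> (exp_end scale T (exp_end scale ?N x))"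
      by simp
    then show "\<phi> (exp_end scale T (exp_end scale ?N x)) = \<phi> x"
      by (rule sums_unique2) (rule sums_single)
  qed
qed

text \<open>
  The Leibniz rule, with the binomial coefficients absorbed into divided powers.
\<close>

lemma derivation_power:
  assumes D: "Vector_Spaces.linear scale scale D"
    and \<beta>l: "\<And>y. Vector_Spaces.linear scale scale (\<lambda>x. \<beta> x y)"
    and \<beta>r: "\<And>x. Vector_Spaces.linear scale scale (\<beta> x)"
    and deriv: "\<And>x y. D (\<beta> x y) = \<beta> (D x) y + \<beta> x (D y)"
  shows "scale (inverse (fact n)) ((D ^^ n) (\<beta> x y)) =
    (\<Sum>i\<le>n. \<beta> (scale (inverse (fact i)) ((D ^^ i) x)) (scale (inverse (fact (n - i))) ((D ^^ (n - i)) y)))"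
proof (induction n)
  case (Suc n)
  define u where "u i = scale (inverse (fact i)) ((D ^^ i) x)" for i
  define v where "v i = scale (inverse (fact i)) ((D ^^ i) y)" for i
  have Du: "D (u i) = scale (of_nat (Suc i)) (u (Suc i))" for i
    by (simp add: u_def lin_scale[OF D] del: of_nat_Suc)
  have Dv: "D (v i) = scale (of_nat (Suc i)) (v (Suc i))" for i
    by (simp add: v_def lin_scale[OF D] del: of_nat_Suc)
  have Suc_scale: "scale (of_nat (Suc n)) (scale (inverse (fact (Suc n))) z) = scale (inverse (fact n)) z" for z
    by (simp del: of_nat_Suc)
  have IH: "scale (inverse (fact n)) ((D ^^ n) (\<beta> x y)) = (\<Sum>i\<le>n. \<beta> (u i) (v (n - i)))"
    unfolding u_def v_def by (rule Suc)
  have "scale (of_nat (Suc n)) (scale (inverse (fact (Suc n))) ((D ^^ Suc n) (\<beta> x y))) =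
      D (scale (inverse (fact n)) ((D ^^ n) (\<beta> x y)))"
    unfolding Suc_scale by (simp add: lin_scale[OF D])
  also have "\<dots> = (\<Sum>i\<le>n. \<beta> (D (u i)) (v (n - i))) + (\<Sum>i\<le>n. \<beta> (u i) (D (v (n - i))))"
    unfolding IH by (simp add: lin_sum[OF D] deriv sum.distrib)
  also have "(\<Sum>i\<le>n. \<beta> (D (u i)) (v (n - i))) = (\<Sum>i\<le>Suc n. scale (of_nat i) (\<beta> (u i) (v (Suc n - i))))"
    by (simp only: sum.atMost_Suc_shift Du lin_scale[OF \<beta>l]) simp
  also have "(\<Sum>i\<le>n. \<beta> (u i) (D (v (n - i)))) = (\<Sum>i\<le>Suc n. scale (of_nat (Suc n - i)) (\<beta> (u i) (v (Suc n - i))))"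
    by (simp only: sum.atMost_Suc Dv lin_scale[OF \<beta>r]) (simp add: Suc_diff_le)
  also have "(\<Sum>i\<le>Suc n. scale (of_nat i) (\<beta> (u i) (v (Suc n - i)))) +
      (\<Sum>i\<le>Suc n. scale (of_nat (Suc n - i)) (\<beta> (u i) (v (Suc n - i)))) =
      (\<Sum>i\<le>Suc n. scale (of_nat (Suc n)) (\<beta> (u i) (v (Suc n - i))))"
    unfolding sum.distrib[symmetric]
  proof (rule sum.cong)
    fix i assume "i \<in> {..Suc n}"
    then have "i + (Suc n - i) = Suc n"
      by simp
    then show "scale (of_nat i) (\<beta> (u i) (v (Suc n - i))) + scale (of_nat (Suc n - i)) (\<beta> (u i) (v (Suc n - i))) =
        scale (of_nat (Suc n)) (\<beta> (u i) (v (Suc n - i)))"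
      by (metis of_nat_add scale_left_distrib)
  qed simp
  also have "\<dots> = scale (of_nat (Suc n)) (\<Sum>i\<le>Suc n. \<beta> (u i) (v (Suc n - i)))"
    by (rule scale_sum_right[symmetric])
  finally show ?case
    unfolding u_def v_def by (simp only: scale_cancel_left of_nat_eq_0_iff) simp
qed simp

lemma exp_end_derivation:
  assumes D: "Vector_Spaces.linear scale scale D"
    and \<beta>l: "\<And>y. Vector_Spaces.linear scale scale (\<lambda>x. \<beta> x y)"
    and \<beta>r: "\<And>x. Vector_Spaces.linear scale scale (\<beta> x)"
    and deriv: "\<And>x y. D (\<beta> x y) = \<beta> (D x) y + \<beta> x (D y)"
  shows "exp_end scale D (\<beta> x y) = \<beta> (exp_end scale D x) (exp_end scale D y)"
proof (rule functional_separates)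
  obtain a where a: "0 \<le> a" "\<And>x. vnorm (D x) \<le> a * vnorm x"
    using linear_bounded[OF D] by blast
  obtain K where K: "0 \<le> K" "\<And>x y. vnorm (\<beta> x y) \<le> K * vnorm x * vnorm y"
    using bilinear_bounded[OF \<beta>l \<beta>r] by blast
  define u where "u i = scale (inverse (fact i)) ((D ^^ i) x)" for i
  define v where "v i = scale (inverse (fact i)) ((D ^^ i) y)" for i
  fix \<phi> assume \<phi>: "functional \<phi>"
  obtain C where C: "C \<ge> 0" "\<And>x. norm (\<phi> x) \<le> C * vnorm x"
    using functional_bounded[OF \<phi>] by blast
  have "functional (\<lambda>z. \<phi> (\<beta> x z))" "functional (\<lambda>z. \<phi> (\<beta> z x))" for x
    using Vector_Spaces.linear_compose[OF \<beta>r \<phi>] Vector_Spaces.linear_compose[OF \<beta>l \<phi>]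
    by (simp_all add: comp_def)
  moreover have "summable (\<lambda>k. norm (\<phi> (\<beta> (u k) z)))" for z
  proof -
    have "norm (norm (\<phi> (\<beta> (u k) z))) \<le> (C * K * vnorm z) * (inverse (fact k) * a ^ k * vnorm x)" for k
    proof -
      have "norm (\<phi> (\<beta> (u k) z)) \<le> C * (K * vnorm (u k) * vnorm z)"
        using C K by (meson mult_left_mono order_trans)
      also have "\<dots> = (C * K * vnorm z) * vnorm (u k)"
        by simp
      also have "\<dots> \<le> (C * K * vnorm z) * (inverse (fact k) * a ^ k * vnorm x)"
        unfolding u_def using exp_term_bound[OF a(2,1)] C(1) K(1) by (intro mult_left_mono) auto
      finally show ?thesis by simp
    qed
    then show ?thesis
      by (intro summable_comparison_test'[OF summable_mult[OF summable_exp_bound]])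
  qed
  moreover have "(\<lambda>k. \<phi> (\<beta> (u k) z)) sums \<phi> (\<beta> (exp_end scale D x) z)" for z
    unfolding u_def by (rule vsumsD[OF vsums_exp_end[OF D] calculation(2)])
  ultimately have "(\<lambda>n. \<Sum>i\<le>n. \<phi> (\<beta> (u i) (v (n - i)))) sums \<phi> (\<beta> (exp_end scale D x) (exp_end scale D y))"
    using exp_term_bound[OF a(2,1)] unfolding v_def
    by (intro Cauchy_product_functionals[OF vsums_exp_end[OF D] summable_exp_bound])
  moreover have "(\<Sum>i\<le>n. \<phi> (\<beta> (u i) (v (n - i)))) = \<phi> (scale (inverse (fact n)) ((D ^^ n) (\<beta> x y)))" for n
    unfolding derivation_power[where \<beta>=\<beta>, OF D \<beta>l \<beta>r deriv] u_def v_def by (simp add: lin_sum[OF \<phi>])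
  ultimately show "\<phi> (exp_end scale D (\<beta> x y)) = \<phi> (\<beta> (exp_end scale D x) (exp_end scale D y))"
    using vsumsD[OF vsums_exp_end[OF D, of "\<beta> x y"] \<phi>] by (simp add: sums_unique2)
qed

text \<open>
  The iterates start at the center of the ball.  As the center moves by at most half the radius, the iterates never
  leave the ball, and their increments form a geometrically dominated series.
\<close>

lemma contraction_fixed_point:
  assumes contr: "\<And>x y. vnorm x \<le> r \<Longrightarrow> vnorm y \<le> r \<Longrightarrow> vnorm (G x - G y) \<le> vnorm (x - y) / 2"
    and start: "vnorm (G 0) \<le> r / 2"
  shows "\<exists>x. vnorm x \<le> r \<and> G x = x"
proof -
  have r: "0 \<le> r"
    using start vnorm_nonneg[of "G 0"] by linarith
  have self_map: "vnorm (G x) \<le> r" if "vnorm x \<le> r" for x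
    using vnorm_triangle[of "G x - G 0" "G 0"] contr[of x 0] that r start by simp
  define X where "X n = (G ^^ n) 0" for n
  have X_Suc: "X (Suc n) = G (X n)" and X_0: "X 0 = 0" for n
    by (simp_all add: X_def)
  have X_r: "vnorm (X n) \<le> r" for n
    by (induction n) (auto simp: X_Suc X_0 r self_map)
  have step: "vnorm (X (Suc n) - X n) \<le> (1 / 2) ^ n * (r / 2)" for n
  proof (induction n)
    case (Suc n)
    have "vnorm (X (Suc (Suc n)) - X (Suc n)) \<le> vnorm (X (Suc n) - X n) / 2"
      unfolding X_Suc[of "Suc n"] X_Suc[of n] using contr[of "G (X n)" "X n"] self_map X_r by blast
    then show ?case using Suc by simp
  qed (use start in \<open>simp add: X_Suc X_0\<close>)
  obtain x where x: "vsums (\<lambda>n. X (Suc n) - X n) x"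
    using absolutely_summable_vsums[OF summable_mult2[OF summable_geometric] step] by auto
  have "(\<lambda>n. coord b (X n - x)) \<longlonglongrightarrow> 0" for b
  proof -
    have "(\<lambda>n. \<Sum>k<n. coord b (X (Suc k) - X k)) = (\<lambda>n. coord b (X n))"
      using sum_lessThan_telescope[of "\<lambda>k. coord b (X k)"]
      by (simp add: lin_diff[OF functional_coord] X_0 lin_zero[OF functional_coord])
    then have "(\<lambda>n. coord b (X n)) \<longlonglongrightarrow> coord b x"
      using vsumsD[OF x functional_coord, of b] by (simp add: sums_def)
    then show ?thesis
      by (simp add: lin_diff[OF functional_coord] LIM_zero)
  qed
  then have lim: "(\<lambda>n. vnorm (X n - x)) \<longlonglongrightarrow> 0"
    unfolding vnorm_def by (intro tendsto_null_sum tendsto_norm_zero)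
  have "vnorm x \<le> r"
  proof (rule tendsto_lowerbound)
    show "(\<lambda>n. r + vnorm (X n - x)) \<longlonglongrightarrow> r"
      using tendsto_add[OF tendsto_const lim, of r] by simp
    have "vnorm x \<le> r + vnorm (X n - x)" for n
      using vnorm_triangle_diff[of "X n" "X n - x"] X_r[of n] by simp
    then show "\<forall>\<^sub>F n in sequentially. vnorm x \<le> r + vnorm (X n - x)"
      by simp
  qed simp
  moreover have "vnorm (G x - x) \<le> 0"
  proof (rule tendsto_lowerbound)
    show "(\<lambda>n. vnorm (X n - x) + vnorm (X (Suc n) - x)) \<longlonglongrightarrow> 0"
      using tendsto_add[OF lim LIMSEQ_Suc[OF lim]] by simp
    have "vnorm (G x - x) \<le> vnorm (X n - x) + vnorm (X (Suc n) - x)" for n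
    proof -
      have "vnorm (G x - x) \<le> vnorm (G x - G (X n)) + vnorm (G (X n) - x)"
        using vnorm_triangle[of "G x - G (X n)" "G (X n) - x"] by simp
      moreover have "vnorm (G x - G (X n)) \<le> vnorm (X n - x) / 2"
        using contr[OF \<open>vnorm x \<le> r\<close> X_r[of n]] by (simp add: vnorm_minus_commute)
      ultimately show ?thesis
        using vnorm_nonneg[of "X n - x"] unfolding X_Suc by linarith
    qed
    then show "\<forall>\<^sub>F n in sequentially. vnorm (G x - x) \<le> vnorm (X n - x) + vnorm (X (Suc n) - x)"
      by simp
  qed simp
  then have "G x = x"
    using antisym[OF _ vnorm_nonneg, of "G x - x"] by simp
  ultimately show ?thesis
    by blast
qed

lemma exp_end_zero: "exp_end scale (\<lambda>_. 0) x = x"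
proof (rule functional_separates)
  fix \<phi> assume \<phi>: "functional \<phi>"
  have "Vector_Spaces.linear scale scale (\<lambda>_. 0)"
    by (simp add: Vector_Spaces.linear_iff vector_space_axioms)
  from vsumsD[OF vsums_exp_end[OF this, of x] \<phi>]
  have "(\<lambda>k. \<phi> (scale (inverse (fact k)) (((\<lambda>_. 0) ^^ k) x))) sums \<phi> (exp_end scale (\<lambda>_. 0) x)" .
  moreover have "\<phi> (scale (inverse (fact k)) (((\<lambda>_. 0) ^^ k) x)) = (if k = 0 then \<phi> x else 0)" for k
    by (cases k) (simp_all add: lin_zero[OF \<phi>])
  ultimately have "(\<lambda>k. if k = 0 then \<phi> x else 0) sums \<phi> (exp_end scale (\<lambda>_. 0) x)"
    by simp
  then show "\<phi> (exp_end scale (\<lambda>_. 0) x) = \<phi> x"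
    by (rule sums_unique2) (rule sums_single)
qed

end

section \<open>Linear algebra of short complexes and spaces of maps\<close>

text \<open>
  With \<open>d g d = d\<close>, the map \<open>g d g\<close> satisfies both identities.
\<close>

lemma generalized_inverse:
  assumes d: "Vector_Spaces.linear s1 s2 d"
  shows "\<exists>s. Vector_Spaces.linear s2 s1 s \<and> (\<forall>x. d (s (d x)) = d x) \<and> (\<forall>y. s (d (s y)) = s y)"
proof -
  interpret d: Vector_Spaces.linear s1 s2 d by fact
  interpret vector_space_pair s1 s2 ..
  obtain g where g: "Vector_Spaces.linear s2 s1 g" "\<And>x. d (g (d x)) = d x"
    using linear_exists_right_inverse_on[OF d d.vs1.subspace_UNIV] by auto
  have "Vector_Spaces.linear s2 s1 (g \<circ> (d \<circ> g))"
    by (intro Vector_Spaces.linear_compose[OF Vector_Spaces.linear_compose[OF g(1) d] g(1)])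
  then show ?thesis
    using g(2) by (intro exI[of _ "g \<circ> (d \<circ> g)"]) simp
qed

text \<open>
  Let \<open>r\<close> be a right inverse of \<open>d1\<close> on its image of \<open>L\<close>.  Then \<open>c - r (d1 c)\<close> is a cocycle in \<open>L\<close>, hence lies
  in the range of \<open>d0\<close>, where \<open>d0 s\<close> is the identity.  Expanding \<open>c - r (d1 c) = d0 (s (c - r (d1 c)))\<close> shows
  that \<open>t = r - d0 s r\<close> works.
\<close>

lemma contracting_homotopy:
  assumes d0: "Vector_Spaces.linear sA sB d0" and d1: "Vector_Spaces.linear sB sC d1"
    and L: "Modules.module.subspace sB L"
    and exact: "\<And>c. c \<in> L \<Longrightarrow> d1 c = 0 \<Longrightarrow> c \<in> range d0"
  shows "\<exists>s t. Vector_Spaces.linear sB sA s \<and> Vector_Spaces.linear sC sB t \<and>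
    (\<forall>c\<in>L. c = d0 (s c) + t (d1 c)) \<and> (\<forall>c. s (d0 (s c)) = s c)"
proof -
  interpret d1: Vector_Spaces.linear sB sC d1 by fact
  interpret vector_space_pair sB sC ..
  obtain s where s: "Vector_Spaces.linear sB sA s" "\<And>x. d0 (s (d0 x)) = d0 x" "\<And>c. s (d0 (s c)) = s c"
    using generalized_inverse[OF d0] by blast
  obtain r where r: "range r \<subseteq> L" "Vector_Spaces.linear sC sB r" "\<And>c. c \<in> L \<Longrightarrow> d1 (r (d1 c)) = d1 c"
    using linear_exists_right_inverse_on[OF d1 L] by blast
  define t where "t = (\<lambda>b. r b - d0 (s (r b)))"
  have "Vector_Spaces.linear sC sB t"
  proof -
    have "Vector_Spaces.linear sC sB (d0 \<circ> (s \<circ> r))"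
      by (intro Vector_Spaces.linear_compose[OF Vector_Spaces.linear_compose[OF r(2) s(1)] d0])
    with r(2) have "Vector_Spaces.linear sC sB (\<lambda>b. r b - (d0 \<circ> (s \<circ> r)) b)"
      unfolding Vector_Spaces.linear_iff by (simp add: d1.vs1.scale_right_diff_distrib)
    then show ?thesis
      by (simp add: t_def)
  qed
  moreover have "c = d0 (s c) + t (d1 c)" if c: "c \<in> L" for c
  proof -
    have "c - r (d1 c) \<in> L"
      using c r(1) L by (auto intro: d1.vs1.subspace_diff)
    moreover have "d1 (c - r (d1 c)) = 0"
      using r(3)[OF c] by (simp add: d1.diff)
    ultimately obtain a where "c - r (d1 c) = d0 a"
      using exact by blast
    then have "d0 (s (c - r (d1 c))) = c - r (d1 c)"
      using s(2) by simp
    then show ?thesis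
      by (simp add: t_def lin_diff[OF s(1)] lin_diff[OF d0] algebra_simps)
  qed
  ultimately show ?thesis
    using s by blast
qed

definition pointwise :: "('k \<Rightarrow> 'b \<Rightarrow> 'b) \<Rightarrow> 'k \<Rightarrow> ('a \<Rightarrow> 'b) \<Rightarrow> 'a \<Rightarrow> 'b" where
  "pointwise sc c g = (\<lambda>x. sc c (g x))"

lemma pointwise_apply [simp]: "pointwise sc c g x = sc c (g x)"
  by (simp add: pointwise_def)

lemma vector_space_pointwise:
  assumes "vector_space sc"
  shows "vector_space (pointwise sc)"
proof -
  interpret vector_space sc by fact
  show ?thesis
    by standard (auto simp: fun_eq_iff scale_right_distrib scale_left_distrib)
qed

lemma sum_fun_apply: "(\<Sum>i\<in>I. g i) x = (\<Sum>i\<in>I. g i x)"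
  by (induction I rule: infinite_finite_induct) auto

text \<open>
  Cochains are determined by their values \<open>w i\<close> on finitely many tuples of basis vectors, with coefficient functions
  \<open>a i\<close> that do not depend on the cochain.  On such functions every linear operator is bounded by the values.
\<close>

lemma (in fd_space) bounded_by_values:
  fixes a :: "'i \<Rightarrow> 'x \<Rightarrow> 'k"
  assumes \<tau>: "Vector_Spaces.linear (pointwise scale) scale \<tau>"
  shows "\<exists>C\<ge>0. \<forall>w. vnorm (\<tau> (\<lambda>x. \<Sum>i\<in>I. scale (a i x) (w i))) \<le> C * (\<Sum>i\<in>I. vnorm (w i))"
proof -
  obtain C where C: "C \<ge> 0" "\<And>k. vnorm (\<tau> (\<Sum>p\<in>I \<times> Basis. pointwise scale (k p) (\<lambda>x. scale (a (fst p) x) (snd p))))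
      \<le> C * (\<Sum>p\<in>I \<times> Basis. norm (k p))"
    using linear_bounded_on_combinations[OF \<tau>, where I="I \<times> Basis" and x="\<lambda>p x. scale (a (fst p) x) (snd p)"]
    by blast
  have "vnorm (\<tau> (\<lambda>x. \<Sum>i\<in>I. scale (a i x) (w i))) \<le> C * (\<Sum>i\<in>I. vnorm (w i))" for w
  proof -
    have "(\<Sum>p\<in>I \<times> Basis. pointwise scale (coord (snd p) (w (fst p))) (\<lambda>x. scale (a (fst p) x) (snd p))) =
        (\<lambda>x. \<Sum>i\<in>I. scale (a i x) (w i))"
    proof
      fix x
      have "(\<Sum>p\<in>I \<times> Basis. pointwise scale (coord (snd p) (w (fst p))) (\<lambda>x. scale (a (fst p) x) (snd p))) x =
          (\<Sum>i\<in>I. \<Sum>e\<in>Basis. scale (a i x) (scale (coord e (w i)) e))"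
        by (simp add: sum_fun_apply sum.cartesian_product case_prod_beta mult.commute)
      also have "\<dots> = (\<Sum>i\<in>I. scale (a i x) (w i))"
        by (simp only: scale_sum_right[symmetric] coord_expansion[symmetric])
      finally show "(\<Sum>p\<in>I \<times> Basis. pointwise scale (coord (snd p) (w (fst p))) (\<lambda>x. scale (a (fst p) x) (snd p))) x =
          (\<Sum>i\<in>I. scale (a i x) (w i))" .
    qed
    with C(2)[of "\<lambda>p. coord (snd p) (w (fst p))"] show ?thesis
      by (simp add: vnorm_def sum.cartesian_product case_prod_beta)
  qed
  with C(1) show ?thesis by blast
qed

lemma exists_projection_along:
  assumes vs: "vector_space sc" and U: "Modules.module.subspace sc U"
  shows "\<exists>q. Vector_Spaces.linear sc sc q \<and> (\<forall>x. q x = 0 \<longleftrightarrow> x \<in> U) \<and> (\<forall>x. q (q x) = q x)"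
proof -
  interpret vector_space sc by fact
  interpret vector_space_pair sc sc ..
  obtain g where g: "range g \<subseteq> U" "Vector_Spaces.linear sc sc g" "\<And>u. u \<in> U \<Longrightarrow> g u = u"
    using linear_exists_left_inverse_on[OF linear_id U] by auto
  have lin: "Vector_Spaces.linear sc sc (\<lambda>x. x - g x)"
    using g(2) by (simp add: Vector_Spaces.linear_iff scale_right_diff_distrib)
  have "x - g x = 0 \<longleftrightarrow> x \<in> U" for x
    using g(1,3) by (metis rangeI subsetD right_minus_eq)
  moreover have "(x - g x) - g (x - g x) = x - g x" for x
    using g(1,3) by (simp add: lin_diff[OF g(2)] image_subset_iff)
  ultimately show ?thesis
    using lin by blast
qed

section \<open>Perturbation of an unobstructed morphism\<close>

lemma small_multiple:
  assumes "0 \<le> a" "0 < b"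
  shows "\<exists>e>0. a * e \<le> (b::real)"
  using assms by (intro exI[of _ "b / (a + 1)"]) (simp add: field_simps)

text \<open>
  The situation of the theorem, with the quotient \<open>W/U\<close> realized inside \<open>W\<close> as the image of a projection \<open>q\<close> with
  kernel \<open>U\<close>, and with the vanishing of \<open>H\<^sup>1\<close> spelled out: every linear map that is a cocycle modulo \<open>U\<close> is
  modulo \<open>U\<close> a coboundary.
\<close>

locale unobstructed_lie_hom =
  V: fd_space sV BV + W: fd_space sW BW + LV: lie_algebra sV \<mu> + LW: lie_algebra sW \<nu>
  for sV :: "'k::real_or_complex \<Rightarrow> 'v::ab_group_add \<Rightarrow> 'v" and BV
    and sW :: "'k \<Rightarrow> 'w::ab_group_add \<Rightarrow> 'w" and BW and \<mu> \<nu> +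
  fixes f :: "'v \<Rightarrow> 'w" and U :: "'w set" and q :: "'w \<Rightarrow> 'w"
  assumes hom_f: "lie_hom sV \<mu> sW \<nu> f"
    and sub_U: "lie_subalgebra sW \<nu> U"
    and f_U: "\<And>x. f x \<in> U"
    and q_linear: "Vector_Spaces.linear sW sW q"
    and q_eq_0_iff: "\<And>x. q x = 0 \<longleftrightarrow> x \<in> U"
    and q_idem: "\<And>x. q (q x) = q x"
    and cocycle_coboundary: "\<And>c. Vector_Spaces.linear sV sW c \<Longrightarrow>
      (\<And>x y. q (\<nu> (f x) (c y) - \<nu> (f y) (c x) - c (\<mu> x y)) = 0) \<Longrightarrow>
      \<exists>w. \<forall>x. q (c x) = q (\<nu> (f x) w)"
begin

lemmas bracket_add_left = lin_add[OF LW.linear_left]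
lemmas bracket_add_right = lin_add[OF LW.linear_right]
lemmas bracket_diff_left = lin_diff[OF LW.linear_left]
lemmas bracket_diff_right = lin_diff[OF LW.linear_right]
lemmas bracket_minus_left = lin_neg[OF LW.linear_left]
lemmas bracket_minus_right = lin_neg[OF LW.linear_right]
lemmas bracket_scale_left = lin_scale[OF LW.linear_left]
lemmas bracket_scale_right = lin_scale[OF LW.linear_right]

lemma f_linear: "Vector_Spaces.linear sV sW f"
  using hom_f by (simp add: lie_hom_def)

text \<open>
  Polarization of \<open>\<nu> x x = 0\<close>.
\<close>

lemma bracket_anticommute: "\<nu> x y = - \<nu> y x"
proof -
  have "\<nu> (x + y) (x + y) = \<nu> x y + \<nu> y x"
    by (simp only: bracket_add_left bracket_add_right) (simp add: LW.alternating)
  then show ?thesis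
    unfolding LW.alternating eq_neg_iff_add_eq_0 by (rule sym)
qed

lemma ad_derivation: "\<nu> w (\<nu> x y) = \<nu> (\<nu> w x) y + \<nu> x (\<nu> w y)"
proof -
  have "\<nu> x (\<nu> y w) = - \<nu> x (\<nu> w y)"
    by (subst bracket_anticommute[of y w]) (rule bracket_minus_right)
  moreover have "\<nu> y (\<nu> w x) = - \<nu> (\<nu> w x) y"
    by (rule bracket_anticommute)
  ultimately have "\<nu> w (\<nu> x y) + - \<nu> x (\<nu> w y) + - \<nu> (\<nu> w x) y = 0"
    using LW.jacobi[of w x y] by simp
  then show ?thesis
    by (simp add: algebra_simps)
qed

definition exp_neg_ad :: "'w \<Rightarrow> 'w \<Rightarrow> 'w" where
  "exp_neg_ad w = exp_end sW (\<nu> (- w))"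

lemma exp_neg_ad_linear: "Vector_Spaces.linear sW sW (exp_neg_ad w)"
  unfolding exp_neg_ad_def by (rule W.linear_exp_end[OF LW.linear_right])

lemma exp_neg_ad_bracket: "exp_neg_ad w (\<nu> x y) = \<nu> (exp_neg_ad w x) (exp_neg_ad w y)"
  unfolding exp_neg_ad_def
  by (rule W.exp_end_derivation[where \<beta>=\<nu>]) (rule LW.linear_right LW.linear_left ad_derivation)+

lemma exp_ad_exp_neg_ad: "exp_end sW (\<nu> w) (exp_neg_ad w x) = x"
proof -
  have "\<nu> (- w) = (\<lambda>x. - \<nu> w x)"
    by (simp add: fun_eq_iff bracket_minus_left)
  then show ?thesis
    unfolding exp_neg_ad_def by (simp only: W.exp_end_minus_inverse[OF LW.linear_right])
qed

lemma exp_neg_ad_0: "exp_neg_ad 0 x = x"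
proof -
  have "\<nu> (- 0) = (\<lambda>_. 0)"
    using lin_zero[OF LW.linear_left] by auto
  then show ?thesis
    unfolding exp_neg_ad_def by (simp only: W.exp_end_zero)
qed

lemma exp_neg_ad_strictly_differentiable:
  assumes "0 < \<eta>"
  shows "\<exists>r>0. \<forall>w w' x. W.vnorm w \<le> r \<longrightarrow> W.vnorm w' \<le> r \<longrightarrow>
    W.vnorm (exp_neg_ad w x - exp_neg_ad w' x + \<nu> (w - w') x) \<le> \<eta> * W.vnorm (w - w') * W.vnorm x"
proof -
  obtain K where K: "0 \<le> K" "\<And>x y. W.vnorm (\<nu> x y) \<le> K * W.vnorm x * W.vnorm y"
    using W.bilinear_bounded[OF LW.linear_left LW.linear_right] by blast
  \<comment> \<open>The constant of \<open>exp_end_diff_bound\<close> tends to \<open>0\<close> with the radius.\<close>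
  have "((\<lambda>r. (exp (K * r) - 1) * K) \<longlongrightarrow> (exp (K * 0) - 1) * K) (at_right 0)"
    by (intro tendsto_intros)
  then have "\<forall>\<^sub>F r in at_right 0. (exp (K * r) - 1) * K < \<eta>"
    using assms by (intro order_tendstoD) auto
  moreover have "\<forall>\<^sub>F r in at_right (0::real). r > 0"
    by (rule eventually_at_right_less)
  ultimately have "\<forall>\<^sub>F r in at_right 0. (exp (K * r) - 1) * K < \<eta> \<and> r > 0"
    by (rule eventually_conj)
  then obtain r where r: "r > 0" "(exp (K * r) - 1) * K < \<eta>"
    using eventually_happens[of _ "at_right (0::real)"] by auto
  have "W.vnorm (exp_neg_ad w x - exp_neg_ad w' x + \<nu> (w - w') x) \<le> \<eta> * W.vnorm (w - w') * W.vnorm x"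
    if w: "W.vnorm w \<le> r" and w': "W.vnorm w' \<le> r" for w w' x
  proof -
    have bound: "W.vnorm (\<nu> (- v) x) \<le> K * r * W.vnorm x" if "W.vnorm v \<le> r" for v x
      using K(2)[of "- v" x] mult_right_mono[OF mult_left_mono[OF that K(1)] W.vnorm_nonneg[of x]]
      by simp
    have diff: "\<nu> (- w) x - \<nu> (- w') x = - \<nu> (w - w') x" for x
      unfolding bracket_minus_left bracket_diff_left by simp
    have "W.vnorm (exp_neg_ad w x - exp_neg_ad w' x - (\<nu> (- w) x - \<nu> (- w') x)) \<le>
        (exp (K * r) - 1) * (K * W.vnorm (w - w')) * W.vnorm x"
      unfolding exp_neg_ad_def
    proof (rule W.exp_end_diff_bound[OF LW.linear_right LW.linear_right bound[OF w] bound[OF w']])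
      show "W.vnorm (\<nu> (- w) x - \<nu> (- w') x) \<le> K * W.vnorm (w - w') * W.vnorm x" for x
        using K(2)[of "w - w'" x] by (simp add: diff)
    qed (use K r in auto)
    also have "\<dots> = (exp (K * r) - 1) * K * (W.vnorm (w - w') * W.vnorm x)"
      by (simp only: mult.assoc)
    also have "\<dots> \<le> \<eta> * (W.vnorm (w - w') * W.vnorm x)"
      using r(2) by (intro mult_right_mono mult_nonneg_nonneg W.vnorm_nonneg less_imp_le)
    finally show ?thesis
      unfolding diff by (simp only: diff_minus_eq_add mult.assoc)
  qed
  then show ?thesis
    using r(1) by blast
qed

text \<open>
  The first two differentials of the Chevalley-Eilenberg complex, with values in the image of \<open>q\<close>.
\<close>

definition d0 :: "'w \<Rightarrow> 'v \<Rightarrow> 'w" where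
  "d0 w = (\<lambda>x. q (\<nu> (f x) w))"

definition d1 :: "('v \<Rightarrow> 'w) \<Rightarrow> 'v \<times> 'v \<Rightarrow> 'w" where
  "d1 c = (\<lambda>(x, y). q (\<nu> (f x) (c y) - \<nu> (f y) (c x) - c (\<mu> x y)))"

text \<open>
  On linear maps this is a norm.
\<close>

definition basis_norm :: "('v \<Rightarrow> 'w) \<Rightarrow> real" where
  "basis_norm c = (\<Sum>b\<in>BV. W.vnorm (c b))"

text \<open>
  The contracting homotopy for the subspace of linear maps with values in the image of \<open>q\<close>.  They are
  linear over the ground field because only such cocycles are known to be coboundaries.
\<close>

lemma homotopy:
  "\<exists>s t. Vector_Spaces.linear (pointwise sW) sW s \<and>
    Vector_Spaces.linear (pointwise sW) (pointwise sW) t \<and>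
    (\<forall>c. Vector_Spaces.linear sV sW c \<longrightarrow> (\<forall>x. q (c x) = c x) \<longrightarrow> c = d0 (s c) + t (d1 c)) \<and>
    (\<forall>c. s (d0 (s c)) = s c)"
proof -
  interpret P: vector_space "pointwise sW :: 'k \<Rightarrow> ('v \<Rightarrow> 'w) \<Rightarrow> 'v \<Rightarrow> 'w"
    by (rule vector_space_pointwise) (rule W.vector_space_axioms)
  have vs2: "vector_space (pointwise sW :: 'k \<Rightarrow> ('v \<times> 'v \<Rightarrow> 'w) \<Rightarrow> 'v \<times> 'v \<Rightarrow> 'w)"
    by (rule vector_space_pointwise) (rule W.vector_space_axioms)
  note q_simps = lin_add[OF q_linear] lin_diff[OF q_linear] lin_scale[OF q_linear] lin_zero[OF q_linear]
  let ?L = "{c. Vector_Spaces.linear sV sW c \<and> (\<forall>x. q (c x) = c x)}"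
  have d0: "Vector_Spaces.linear sW (pointwise sW) d0"
    unfolding Vector_Spaces.linear_iff
    by (auto simp: W.vector_space_axioms P.vector_space_axioms d0_def fun_eq_iff q_simps bracket_add_right bracket_scale_right)
  have d1: "Vector_Spaces.linear (pointwise sW) (pointwise sW) d1"
    unfolding Vector_Spaces.linear_iff
    by (auto simp: vs2 P.vector_space_axioms d1_def fun_eq_iff q_simps bracket_add_right bracket_scale_right
      W.scale_right_diff_distrib)
  have L: "P.subspace ?L"
    by (rule P.subspaceI)
      (auto simp: Vector_Spaces.linear_iff q_simps W.scale_right_distrib V.vector_space_axioms W.vector_space_axioms mult.commute)
  have "c \<in> range d0" if "c \<in> ?L" "d1 c = 0" for c
  proof -
    have "q (\<nu> (f x) (c y) - \<nu> (f y) (c x) - c (\<mu> x y)) = 0" for x y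
      using fun_cong[OF that(2), of "(x, y)"] by (simp add: d1_def)
    with cocycle_coboundary[of c] that(1) obtain w where "\<forall>x. q (c x) = q (\<nu> (f x) w)"
      by auto
    then have "c = d0 w"
      using that(1) by (auto simp: d0_def)
    then show ?thesis
      by blast
  qed
  then have "\<exists>s t. Vector_Spaces.linear (pointwise sW) sW s \<and>
      Vector_Spaces.linear (pointwise sW) (pointwise sW) t \<and>
      (\<forall>c\<in>?L. c = d0 (s c) + t (d1 c)) \<and> (\<forall>c. s (d0 (s c)) = s c)"
    by (rule contracting_homotopy[OF d0 d1 L])
  then show ?thesis
    by (simp only: mem_Collect_eq Ball_def imp_conjL)
qed

lemma linear_bounded_basis_norm:
  assumes "Vector_Spaces.linear (pointwise sW) sW s"
  shows "\<exists>C\<ge>0. \<forall>c. Vector_Spaces.linear sV sW c \<longrightarrow> W.vnorm (s c) \<le> C * basis_norm c"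
proof -
  obtain C where C: "C \<ge> 0"
    "\<And>w. W.vnorm (s (\<lambda>x. \<Sum>b\<in>BV. sW (V.coord b x) (w b))) \<le> C * (\<Sum>b\<in>BV. W.vnorm (w b))"
    using W.bounded_by_values[OF assms, where I=BV and a="V.coord"] by blast
  have "W.vnorm (s c) \<le> C * basis_norm c" if "Vector_Spaces.linear sV sW c" for c
    using C(2)[of c] by (simp add: basis_norm_def flip: V.linear_coord_expansion[OF that])
  with C(1) show ?thesis by blast
qed

lemma bilinear_bounded_basis_norm:
  assumes t: "Vector_Spaces.linear (pointwise sW) (pointwise sW) t"
  shows "\<exists>C\<ge>0. \<forall>\<beta>. (\<forall>y. Vector_Spaces.linear sV sW (\<lambda>x. \<beta> (x, y))) \<longrightarrow>
    (\<forall>x. Vector_Spaces.linear sV sW (\<lambda>y. \<beta> (x, y))) \<longrightarrow>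
    basis_norm (t \<beta>) \<le> C * (\<Sum>p\<in>BV \<times> BV. W.vnorm (\<beta> p))"
proof -
  have t_at: "Vector_Spaces.linear (pointwise sW) sW (\<lambda>\<beta>. t \<beta> b)" for b
    using t by (auto simp: Vector_Spaces.linear_iff W.vector_space_axioms)
  define T where "T w b = W.vnorm (t (\<lambda>x. \<Sum>p\<in>BV \<times> BV. sW (V.coord (fst p) (fst x) * V.coord (snd p) (snd x)) (w p)) b)"
    for w :: "'v \<times> 'v \<Rightarrow> 'w" and b
  have "\<exists>C\<ge>0. \<forall>w. T w b \<le> C * (\<Sum>p\<in>BV \<times> BV. W.vnorm (w p))" for b
    unfolding T_def
    using W.bounded_by_values[OF t_at, where I="BV \<times> BV"
        and a="\<lambda>p x. V.coord (fst p) (fst x) * V.coord (snd p) (snd x)"] .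
  then obtain C where C: "\<And>b. 0 \<le> C b"
    "\<And>b w. T w b \<le> C b * (\<Sum>p\<in>BV \<times> BV. W.vnorm (w p))"
    by metis
  have bound: "basis_norm (t \<beta>) \<le> sum C BV * (\<Sum>p\<in>BV \<times> BV. W.vnorm (\<beta> p))"
    if l: "\<And>y. Vector_Spaces.linear sV sW (\<lambda>x. \<beta> (x, y))" and r: "\<And>x. Vector_Spaces.linear sV sW (\<lambda>y. \<beta> (x, y))" for \<beta>
  proof -
    have "\<beta> x = (\<Sum>p\<in>BV \<times> BV. sW (V.coord (fst p) (fst x) * V.coord (snd p) (snd x)) (\<beta> p))" for x
    proof -
      have "\<beta> x = (\<Sum>b\<in>BV. sW (V.coord b (fst x)) (\<Sum>b'\<in>BV. sW (V.coord b' (snd x)) (\<beta> (b, b'))))"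
        unfolding V.linear_coord_expansion[OF r, symmetric]
        using V.linear_coord_expansion[OF l, of "fst x" "snd x"] unfolding prod.collapse .
      also have "\<dots> = (\<Sum>p\<in>BV \<times> BV. sW (V.coord (fst p) (fst x) * V.coord (snd p) (snd x)) (\<beta> p))"
        by (simp add: W.scale_sum_right sum.cartesian_product case_prod_beta)
      finally show ?thesis .
    qed
    then have \<beta>: "(\<lambda>x. \<Sum>p\<in>BV \<times> BV. sW (V.coord (fst p) (fst x) * V.coord (snd p) (snd x)) (\<beta> p)) = \<beta>"
      by (intro ext) (rule sym)
    have "W.vnorm (t \<beta> b) \<le> C b * (\<Sum>p\<in>BV \<times> BV. W.vnorm (\<beta> p))" for b
      using C(2)[where w=\<beta> and b=b] unfolding T_def \<beta> .
    then show ?thesis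
      unfolding basis_norm_def sum_distrib_right by (intro sum_mono)
  qed
  have "0 \<le> sum C BV"
    using C(1) by (simp add: sum_nonneg)
  then show ?thesis
    by (intro exI[of _ "sum C BV"] conjI allI impI bound) simp_all
qed

lemma basis_norm_nonneg: "0 \<le> basis_norm c"
  by (simp add: basis_norm_def sum_nonneg)

lemma basis_norm_le:
  assumes "\<And>b. b \<in> BV \<Longrightarrow> W.vnorm (h b) \<le> k * W.vnorm (u b) + l * W.vnorm (v b)"
  shows "basis_norm h \<le> k * basis_norm u + l * basis_norm v"
  unfolding basis_norm_def sum_distrib_left sum.distrib[symmetric] by (rule sum_mono) (rule assms)

lemma linear_compose_q_exp_neg_ad:
  assumes "Vector_Spaces.linear sV sW g"
  shows "Vector_Spaces.linear sV sW (\<lambda>x. q (exp_neg_ad w (g x)))"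
  using Vector_Spaces.linear_compose[OF Vector_Spaces.linear_compose[OF assms exp_neg_ad_linear] q_linear]
  by (simp add: comp_def)

text \<open>
  The equation to be solved is \<open>s c = 0\<close> for \<open>c = q \<circ> exp (ad (- w)) \<circ> g\<close>.  It follows from the fixed point equation
  \<open>w = s (d0 w - c)\<close>: a solution \<open>w\<close> of the latter lies in the range of \<open>s\<close>, so \<open>s (d0 w) = w\<close>, and \<open>s c = 0\<close> is
  left.  The derivative of \<open>c\<close> in \<open>w\<close> at \<open>w = 0\<close> and \<open>g = f\<close> is \<open>d0\<close>, so the right-hand side of the fixed point
  equation has derivative \<open>0\<close> there.  By strict differentiability it is a contraction near \<open>w = 0\<close> when \<open>g\<close> is close
  to \<open>f\<close>.
\<close>

lemma normalizing_conjugation: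
  assumes s: "Vector_Spaces.linear (pointwise sW) sW s" and s_d0: "\<And>c. s (d0 (s c)) = s c"
    and "0 < \<kappa>"
  shows "\<exists>\<epsilon>>0. \<forall>g. Vector_Spaces.linear sV sW g \<longrightarrow> basis_norm (\<lambda>x. g x - f x) < \<epsilon> \<longrightarrow>
    (\<exists>w. s (\<lambda>x. q (exp_neg_ad w (g x))) = 0 \<and> basis_norm (\<lambda>x. exp_neg_ad w (g x) - f x) \<le> \<kappa>)"
proof -
  obtain K where K: "0 \<le> K" "\<And>x y. W.vnorm (\<nu> x y) \<le> K * W.vnorm x * W.vnorm y"
    using W.bilinear_bounded[where \<beta>=\<nu>] LW.linear_left LW.linear_right by blast
  obtain Q where Q: "0 \<le> Q" "\<And>x. W.vnorm (q x) \<le> Q * W.vnorm x"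
    using W.linear_bounded[OF q_linear] by blast
  obtain C where C: "0 \<le> C" "\<And>c. Vector_Spaces.linear sV sW c \<Longrightarrow> W.vnorm (s c) \<le> C * basis_norm c"
    using linear_bounded_basis_norm[OF s] by blast
  define F where "F = basis_norm f + 1"
  have F: "0 \<le> F"
    by (simp add: F_def basis_norm_nonneg)
  obtain \<eta> where \<eta>: "0 < \<eta>" "C * Q * F * \<eta> \<le> 1 / 4"
    using small_multiple[of "C * Q * F" "1 / 4"] C(1) Q(1) F by auto
  obtain r0 where r0: "0 < r0" "\<And>w w' x. W.vnorm w \<le> r0 \<Longrightarrow> W.vnorm w' \<le> r0 \<Longrightarrow>
      W.vnorm (exp_neg_ad w x - exp_neg_ad w' x + \<nu> (w - w') x) \<le> \<eta> * W.vnorm (w - w') * W.vnorm x"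
    using exp_neg_ad_strictly_differentiable[OF \<eta>(1)] by blast
  obtain r1 where r1: "0 < r1" "(K + \<eta>) * F * r1 \<le> \<kappa> / 2"
    using small_multiple[of "(K + \<eta>) * F" "\<kappa> / 2"] K(1) F \<eta>(1) \<open>0 < \<kappa>\<close> by auto
  define r where "r = min r0 r1"
  have r: "0 < r" "r \<le> r0"
    using r0(1) r1(1) by (auto simp: r_def)
  have r_\<kappa>: "(K + \<eta>) * F * r \<le> \<kappa> / 2"
    by (rule order_trans[OF mult_left_mono r1(2)]) (use K(1) F \<eta>(1) in \<open>simp_all add: r_def\<close>)
  obtain e1 where e1: "0 < e1" "C * Q * e1 \<le> r / 2"
    using small_multiple[of "C * Q" "r / 2"] C(1) Q(1) r(1) by auto
  obtain e2 where e2: "0 < e2" "C * Q * K * e2 \<le> 1 / 4"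
    using small_multiple[of "C * Q * K" "1 / 4"] C(1) Q(1) K(1) by auto
  define \<epsilon> where "\<epsilon> = Min {1, \<kappa> / 2, e1, e2}"
  have \<epsilon>: "0 < \<epsilon>" "\<epsilon> \<le> 1" "\<epsilon> \<le> \<kappa> / 2" "\<epsilon> \<le> e1" "\<epsilon> \<le> e2"
    using e1(1) e2(1) \<open>0 < \<kappa>\<close> by (auto simp: \<epsilon>_def)
  have "\<exists>w. s (\<lambda>x. q (exp_neg_ad w (g x))) = 0 \<and> basis_norm (\<lambda>x. exp_neg_ad w (g x) - f x) \<le> \<kappa>"
    if g: "Vector_Spaces.linear sV sW g" and close: "basis_norm (\<lambda>x. g x - f x) < \<epsilon>" for g
  proof -
    define D where "D = basis_norm (\<lambda>x. g x - f x)"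
    have D: "0 \<le> D" "D < \<epsilon>"
      using close by (simp_all add: D_def basis_norm_nonneg)
    have gF: "basis_norm g \<le> F"
    proof -
      have "basis_norm g \<le> 1 * basis_norm f + 1 * D"
        unfolding D_def
      proof (rule basis_norm_le)
        show "W.vnorm (g b) \<le> 1 * W.vnorm (f b) + 1 * W.vnorm (g b - f b)" for b
          using W.vnorm_triangle[of "f b" "g b - f b"] by simp
      qed
      then show ?thesis
        using D \<epsilon>(2) by (simp add: F_def)
    qed
    define G where "G w = s (\<lambda>x. d0 w x - q (exp_neg_ad w (g x)))" for w
    have contr: "W.vnorm (G w - G w') \<le> W.vnorm (w - w') / 2"
      if w: "W.vnorm w \<le> r" and w': "W.vnorm w' \<le> r" for w w'
    proof -
      define d where "d = W.vnorm (w - w')"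
      \<comment> \<open>The difference of the two values is \<open>s\<close> applied to the error of the linear approximation of \<open>c\<close> by \<open>d0\<close>.\<close>
      define h where "h x = q (- \<nu> (g x - f x) (w - w') - (exp_neg_ad w (g x) - exp_neg_ad w' (g x) + \<nu> (w - w') (g x)))" for x
      have h_eq: "h x = (d0 w x - q (exp_neg_ad w (g x))) - (d0 w' x - q (exp_neg_ad w' (g x)))" for x
        unfolding h_def d0_def lin_diff[OF q_linear, symmetric]
        by (rule arg_cong[where f=q])
          (simp add: bracket_diff_left bracket_diff_right bracket_anticommute[of w] bracket_anticommute[of w'])
      have Gh: "G w - G w' = s h"
        unfolding G_def lin_diff[OF s, symmetric]
        by (rule arg_cong[where f=s]) (simp add: fun_eq_iff h_eq)
      have h_linear: "Vector_Spaces.linear sV sW h"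
      proof -
        have "Vector_Spaces.linear sV sW (\<lambda>x. q (exp_neg_ad w (g x)))" "Vector_Spaces.linear sV sW (\<lambda>x. q (exp_neg_ad w' (g x)))"
          using linear_compose_q_exp_neg_ad[OF g] by blast+
        moreover have "Vector_Spaces.linear sV sW (d0 w)" for w
          using f_linear q_linear
          by (auto simp: Vector_Spaces.linear_iff d0_def bracket_add_left bracket_scale_left)
        ultimately show ?thesis
          unfolding h_eq[abs_def] Vector_Spaces.linear_iff by (simp add: W.scale_right_diff_distrib)
      qed
      have "basis_norm h \<le> (Q * K * d) * D + (Q * \<eta> * d) * basis_norm g"
        unfolding D_def
      proof (rule basis_norm_le)
        fix b
        have "W.vnorm (- \<nu> (g b - f b) (w - w')) \<le> K * W.vnorm (g b - f b) * d"
          using K(2) by (simp add: d_def)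
        moreover have "W.vnorm (exp_neg_ad w (g b) - exp_neg_ad w' (g b) + \<nu> (w - w') (g b)) \<le> \<eta> * d * W.vnorm (g b)"
          unfolding d_def using r0(2) w w' r(2) by simp
        ultimately have "W.vnorm (- \<nu> (g b - f b) (w - w') - (exp_neg_ad w (g b) - exp_neg_ad w' (g b) + \<nu> (w - w') (g b)))
            \<le> K * W.vnorm (g b - f b) * d + \<eta> * d * W.vnorm (g b)"
          by (intro order_trans[OF W.vnorm_triangle_diff] add_mono)
        then have "W.vnorm (h b) \<le> Q * (K * W.vnorm (g b - f b) * d + \<eta> * d * W.vnorm (g b))"
          unfolding h_def by (intro order_trans[OF Q(2)] mult_left_mono Q(1))
        then show "W.vnorm (h b) \<le> Q * K * d * W.vnorm (g b - f b) + Q * \<eta> * d * W.vnorm (g b)"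
          by (simp add: algebra_simps)
      qed
      from mult_left_mono[OF this C(1)]
      have "W.vnorm (G w - G w') \<le> C * ((Q * K * d) * D + (Q * \<eta> * d) * basis_norm g)"
        unfolding Gh by (rule order_trans[OF C(2)[OF h_linear]])
      also have "\<dots> = (C * Q * K * D + C * Q * basis_norm g * \<eta>) * d"
        by (simp add: algebra_simps)
      also have "\<dots> \<le> (1 / 4 + 1 / 4) * d"
      proof (intro mult_right_mono add_mono)
        show "C * Q * K * D \<le> 1 / 4"
          by (rule order_trans[OF mult_left_mono e2(2)]) (use D \<epsilon> C Q K in auto)
        show "C * Q * basis_norm g * \<eta> \<le> 1 / 4"
          by (rule order_trans[OF mult_right_mono[OF mult_left_mono[OF gF]] \<eta>(2)]) (use C Q \<eta> in auto)
      qed (simp add: d_def)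
      finally show ?thesis
        by (simp add: d_def)
    qed
    have start: "W.vnorm (G 0) \<le> r / 2"
    proof -
      have G0: "G 0 = s (\<lambda>x. q (f x - g x))"
        unfolding G_def d0_def exp_neg_ad_0 lin_zero[OF LW.linear_right] lin_zero[OF q_linear]
        by (rule arg_cong[where f=s]) (auto simp: fun_eq_iff lin_diff[OF q_linear] q_eq_0_iff f_U)
      have "Vector_Spaces.linear sV sW (\<lambda>x. q (f x - g x))"
        using f_linear g q_linear
        by (auto simp: Vector_Spaces.linear_iff lin_diff[OF q_linear] W.scale_right_diff_distrib)
      then have "W.vnorm (G 0) \<le> C * basis_norm (\<lambda>x. q (f x - g x))"
        unfolding G0 by (rule C(2))
      also have "basis_norm (\<lambda>x. q (f x - g x)) \<le> Q * D + 0 * D"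
        unfolding D_def by (rule basis_norm_le) (simp add: Q(2) W.vnorm_minus_commute[of "g _"])
      also have "C * (Q * D + 0 * D) \<le> r / 2"
        by (rule order_trans[OF _ e1(2)]) (use D \<epsilon> C Q in \<open>simp add: mult.assoc mult_left_mono\<close>)
      finally show ?thesis
        using C(1) by (simp add: mult_left_mono)
    qed
    obtain w where w: "W.vnorm w \<le> r" "G w = w"
      using W.contraction_fixed_point[of r G, OF contr start] by blast
    have "s (d0 w) = w"
      using s_d0[of "\<lambda>x. d0 w x - q (exp_neg_ad w (g x))"] w(2) by (simp add: G_def)
    moreover have "G w = s (d0 w) - s (\<lambda>x. q (exp_neg_ad w (g x)))"
      unfolding G_def lin_diff[OF s, symmetric] by (rule arg_cong[where f=s]) (simp add: fun_eq_iff)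
    ultimately have "s (\<lambda>x. q (exp_neg_ad w (g x))) = 0"
      using w(2) by simp
    moreover have "basis_norm (\<lambda>x. exp_neg_ad w (g x) - f x) \<le> \<kappa>"
    proof -
      have "basis_norm (\<lambda>x. exp_neg_ad w (g x) - f x) \<le> ((K + \<eta>) * r) * basis_norm g + 1 * D"
        unfolding D_def
      proof (rule basis_norm_le)
        fix b
        let ?y = "g b"
        define z where "z = exp_neg_ad w ?y - exp_neg_ad 0 ?y + \<nu> (w - 0) ?y"
        have "exp_neg_ad w ?y - f b = (z - \<nu> w ?y) + (?y - f b)"
          by (simp add: z_def exp_neg_ad_0)
        then have Aw: "W.vnorm (exp_neg_ad w ?y - f b) = W.vnorm ((z - \<nu> w ?y) + (?y - f b))"
          by (rule arg_cong)
        have "W.vnorm (exp_neg_ad w ?y - f b) \<le> W.vnorm z + W.vnorm (\<nu> w ?y) + W.vnorm (?y - f b)"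
          using W.vnorm_triangle[of "z - \<nu> w ?y" "?y - f b"] W.vnorm_triangle_diff[of z "\<nu> w ?y"]
          unfolding Aw by linarith
        moreover have "W.vnorm z \<le> \<eta> * r * W.vnorm ?y"
        proof -
          have "W.vnorm z \<le> \<eta> * W.vnorm (w - 0) * W.vnorm ?y"
            unfolding z_def by (rule r0(2)) (use w r r0 in auto)
          also have "\<dots> \<le> \<eta> * r * W.vnorm ?y"
            by (intro mult_right_mono mult_left_mono) (use w \<eta> in auto)
          finally show ?thesis .
        qed
        moreover have "W.vnorm (\<nu> w ?y) \<le> K * r * W.vnorm ?y"
          by (rule order_trans[OF K(2)]) (intro mult_right_mono mult_left_mono w K W.vnorm_nonneg)
        ultimately show "W.vnorm (exp_neg_ad w ?y - f b) \<le> (K + \<eta>) * r * W.vnorm ?y + 1 * W.vnorm (?y - f b)"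
          by (simp add: algebra_simps)
      qed
      also have "\<dots> \<le> (K + \<eta>) * r * F + 1 * D"
        by (intro add_right_mono mult_left_mono gF) (use K \<eta> r in auto)
      also have "\<dots> \<le> \<kappa>"
        using r_\<kappa> D(2) \<epsilon>(3) unfolding mult.assoc mult.commute[of r F] by linarith
      finally show ?thesis .
    qed
    ultimately show ?thesis
      by blast
  qed
  then show ?thesis
    using \<epsilon>(1) by blast
qed

lemma d1_bilinear:
  assumes c: "Vector_Spaces.linear sV sW c"
  shows "Vector_Spaces.linear sV sW (\<lambda>x. d1 c (x, y))" "Vector_Spaces.linear sV sW (\<lambda>y. d1 c (x, y))"
proof -
  note simps = lin_add[OF q_linear] lin_diff[OF q_linear] lin_scale[OF q_linear] lin_add[OF f_linear] lin_scale[OF f_linear]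
    lin_add[OF c] lin_scale[OF c] lin_add[OF LV.linear_left] lin_add[OF LV.linear_right]
    lin_scale[OF LV.linear_left] lin_scale[OF LV.linear_right]
    bracket_add_left bracket_add_right bracket_scale_left bracket_scale_right W.scale_right_diff_distrib
  show "Vector_Spaces.linear sV sW (\<lambda>x. d1 c (x, y))" "Vector_Spaces.linear sV sW (\<lambda>y. d1 c (x, y))"
    by (simp_all add: Vector_Spaces.linear_iff V.vector_space_axioms W.vector_space_axioms d1_def simps)
qed

text \<open>
  Put \<open>c = q \<circ> a\<close> and \<open>u = a - c\<close>, which takes values in \<open>U\<close>.  Modulo \<open>U\<close>, where the brackets of values of \<open>u\<close>
  vanish, the morphism equation for \<open>a\<close> reads \<open>c (\<mu> x y) = \<nu> (c x) (a y) + \<nu> (u x) (c y)\<close>.  Hence \<open>d1 c\<close> is the class of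
  \<open>\<nu> (f x - u x) (c y) + \<nu> (c x) (f y - a y)\<close>, a small multiple of \<open>c\<close>.  On the other hand \<open>s c = 0\<close> makes
  \<open>c = t (d1 c)\<close>.
\<close>

lemma close_normalized_hom_into_U:
  assumes t: "Vector_Spaces.linear (pointwise sW) (pointwise sW) t"
    and homotopy: "\<And>c. Vector_Spaces.linear sV sW c \<Longrightarrow> (\<And>x. q (c x) = c x) \<Longrightarrow> c = d0 (s c) + t (d1 c)"
  shows "\<exists>\<kappa>>0. \<forall>a. lie_hom sV \<mu> sW \<nu> a \<longrightarrow> s (\<lambda>x. q (a x)) = 0 \<longrightarrow>
    basis_norm (\<lambda>x. a x - f x) \<le> \<kappa> \<longrightarrow> range a \<subseteq> U"
proof -
  obtain K where K: "0 \<le> K" "\<And>x y. W.vnorm (\<nu> x y) \<le> K * W.vnorm x * W.vnorm y"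
    using W.bilinear_bounded[where \<beta>=\<nu>] LW.linear_left LW.linear_right by blast
  obtain Q where Q: "0 \<le> Q" "\<And>x. W.vnorm (q x) \<le> Q * W.vnorm x"
    using W.linear_bounded[OF q_linear] by blast
  obtain C where C: "0 \<le> C" and C_bilinear: "\<forall>\<beta>. (\<forall>y. Vector_Spaces.linear sV sW (\<lambda>x. \<beta> (x, y))) \<longrightarrow>
      (\<forall>x. Vector_Spaces.linear sV sW (\<lambda>y. \<beta> (x, y))) \<longrightarrow>
      basis_norm (t \<beta>) \<le> C * (\<Sum>p\<in>BV \<times> BV. W.vnorm (\<beta> p))"
    using bilinear_bounded_basis_norm[OF t] by (elim exE conjE) (rule that)
  obtain \<kappa> where \<kappa>: "0 < \<kappa>" "C * (Q * K * (2 + Q)) * \<kappa> \<le> 1 / 2"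
    using small_multiple[of "C * (Q * K * (2 + Q))" "1 / 2"] C Q(1) K(1) by auto
  have "range a \<subseteq> U"
    if hom: "lie_hom sV \<mu> sW \<nu> a" and s0: "s (\<lambda>x. q (a x)) = 0"
      and close: "basis_norm (\<lambda>x. a x - f x) \<le> \<kappa>" for a
  proof -
    have a: "Vector_Spaces.linear sV sW a" "\<And>x y. a (\<mu> x y) = \<nu> (a x) (a y)"
      using hom by (auto simp: lie_hom_def)
    define c where "c x = q (a x)" for x
    define u where "u x = a x - c x" for x
    define D where "D = basis_norm (\<lambda>x. a x - f x)"
    have c_linear: "Vector_Spaces.linear sV sW c"
      using Vector_Spaces.linear_compose[OF a(1) q_linear] by (simp add: c_def[abs_def] comp_def)
    have u_U: "u x \<in> U" for x
      unfolding q_eq_0_iff[symmetric] by (simp add: u_def c_def lin_diff[OF q_linear] q_idem)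
    have c_le: "W.vnorm (c x) \<le> Q * W.vnorm (a x - f x)" for x
    proof -
      have "c x = q (a x - f x)"
        using q_eq_0_iff f_U by (simp add: c_def lin_diff[OF q_linear])
      then show ?thesis
        using Q(2) by simp
    qed
    have d1_le: "W.vnorm (d1 c (x, y)) \<le> Q * K * ((1 + Q) * W.vnorm (a x - f x) * W.vnorm (c y) +
        W.vnorm (c x) * W.vnorm (a y - f y))" for x y
    proof -
      have "q (\<nu> (u x) (u y)) = 0"
        using sub_U u_U by (simp add: q_eq_0_iff lie_subalgebra_def)
      moreover have "\<nu> (f x) (c y) - \<nu> (f y) (c x) - \<nu> (a x) (a y) =
          (\<nu> (f x - u x) (c y) + \<nu> (c x) (f y - a y)) - \<nu> (u x) (u y)"
        by (simp add: u_def bracket_diff_left bracket_diff_right bracket_anticommute[of "f y"])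
      moreover have "d1 c (x, y) = q (\<nu> (f x) (c y) - \<nu> (f y) (c x) - \<nu> (a x) (a y))"
        by (simp add: d1_def c_def a(2) lin_diff[OF q_linear] q_idem)
      ultimately have "d1 c (x, y) = q (\<nu> (f x - u x) (c y) + \<nu> (c x) (f y - a y))"
        by (simp add: lin_diff[OF q_linear])
      then have "W.vnorm (d1 c (x, y)) \<le> Q * W.vnorm (\<nu> (f x - u x) (c y) + \<nu> (c x) (f y - a y))"
        using Q(2) by simp
      also have "\<dots> \<le> Q * (K * ((1 + Q) * W.vnorm (a x - f x)) * W.vnorm (c y) + K * W.vnorm (c x) * W.vnorm (a y - f y))"
      proof (intro mult_left_mono order_trans[OF W.vnorm_triangle] add_mono Q(1))
        have "W.vnorm (f x - u x) \<le> W.vnorm (f x - a x) + W.vnorm (c x)"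
          using W.vnorm_triangle[of "f x - a x" "c x"] by (simp add: u_def algebra_simps)
        then have "W.vnorm (f x - u x) \<le> (1 + Q) * W.vnorm (a x - f x)"
          using c_le[of x] by (simp add: algebra_simps W.vnorm_minus_commute[of "f x"])
        then show "W.vnorm (\<nu> (f x - u x) (c y)) \<le> K * ((1 + Q) * W.vnorm (a x - f x)) * W.vnorm (c y)"
          by (intro order_trans[OF K(2)] mult_right_mono mult_left_mono K(1) W.vnorm_nonneg)
        show "W.vnorm (\<nu> (c x) (f y - a y)) \<le> K * W.vnorm (c x) * W.vnorm (a y - f y)"
          using K(2)[of "c x" "f y - a y"] by (simp add: W.vnorm_minus_commute[of "f y"])
      qed
      finally show ?thesis
        by (simp add: algebra_simps)
    qed
    have d1_sum: "(\<Sum>p\<in>BV \<times> BV. W.vnorm (d1 c p)) \<le> Q * K * (2 + Q) * D * basis_norm c"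
    proof -
      have "(\<Sum>p\<in>BV \<times> BV. W.vnorm (d1 c p)) = (\<Sum>b\<in>BV. \<Sum>b'\<in>BV. W.vnorm (d1 c (b, b')))"
        by (simp add: sum.cartesian_product)
      also have "\<dots> \<le> (\<Sum>b\<in>BV. \<Sum>b'\<in>BV. Q * K * ((1 + Q) * W.vnorm (a b - f b) * W.vnorm (c b') +
        W.vnorm (c b) * W.vnorm (a b' - f b')))"
        by (intro sum_mono d1_le)
      also have "\<dots> = Q * K * ((1 + Q) * D * basis_norm c + basis_norm c * D)"
        unfolding D_def basis_norm_def
        by (simp add: sum.distrib mult.assoc flip: sum_distrib_left sum_distrib_right)
      finally show ?thesis
        by (simp add: algebra_simps)
    qed
    have "c = t (d1 c)"
    proof -
      have "c = d0 (s c) + t (d1 c)"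
        by (rule homotopy[OF c_linear]) (simp add: c_def q_idem)
      moreover have "d0 (s c) = 0"
        using s0 by (simp add: c_def[abs_def] d0_def fun_eq_iff lin_zero[OF LW.linear_right] lin_zero[OF q_linear])
      ultimately show ?thesis
        by simp
    qed
    then have "basis_norm c \<le> C * (\<Sum>p\<in>BV \<times> BV. W.vnorm (d1 c p))"
      using C_bilinear[rule_format, of "d1 c", OF d1_bilinear[OF c_linear]] by simp
    also have "\<dots> \<le> C * (Q * K * (2 + Q) * D * basis_norm c)"
      using d1_sum C by (rule mult_left_mono)
    also have "\<dots> = C * (Q * K * (2 + Q)) * D * basis_norm c"
      by (simp add: mult_ac)
    also have "\<dots> \<le> 1 / 2 * basis_norm c"
    proof (intro mult_right_mono basis_norm_nonneg)
      show "C * (Q * K * (2 + Q)) * D \<le> 1 / 2"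
        by (rule order_trans[OF mult_left_mono \<kappa>(2)]) (use close C Q K in \<open>simp_all add: D_def\<close>)
    qed
    finally have "basis_norm c = 0"
      using basis_norm_nonneg[of c] by linarith
    then have "c b = 0" if "b \<in> BV" for b
      using that by (simp add: basis_norm_def sum_nonneg_eq_0_iff V.finite_Basis)
    then have "c x = 0" for x
      by (subst V.linear_coord_expansion[OF c_linear]) simp
    then show ?thesis
      using q_eq_0_iff by (auto simp: c_def)
  qed
  then show ?thesis
    using \<kappa>(1) by blast
qed

text \<open>
  For \<open>g\<close> close to \<open>f\<close>, normalize \<open>g\<close> by a small conjugation.  The result is a morphism into \<open>U\<close>, and conjugating
  back gives the claim.
\<close>

lemma close_hom_conjugate_into_U:
  "\<exists>\<epsilon>>0. \<forall>g. lie_hom sV \<mu> sW \<nu> g \<longrightarrow> basis_norm (\<lambda>x. g x - f x) < \<epsilon> \<longrightarrow>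
    (\<exists>w. range g \<subseteq> exp_end sW (\<nu> w) ` U)"
proof -
  obtain s t where s: "Vector_Spaces.linear (pointwise sW) sW s" "\<And>c. s (d0 (s c)) = s c"
    and t: "Vector_Spaces.linear (pointwise sW) (pointwise sW) t"
    and homotopy: "\<And>c. Vector_Spaces.linear sV sW c \<Longrightarrow> (\<And>x. q (c x) = c x) \<Longrightarrow> c = d0 (s c) + t (d1 c)"
    using homotopy by blast
  obtain \<kappa> where \<kappa>: "0 < \<kappa>" "\<And>a. lie_hom sV \<mu> sW \<nu> a \<Longrightarrow> s (\<lambda>x. q (a x)) = 0 \<Longrightarrow>
      basis_norm (\<lambda>x. a x - f x) \<le> \<kappa> \<Longrightarrow> range a \<subseteq> U"
    using close_normalized_hom_into_U[OF t homotopy] by blast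
  obtain \<epsilon> where \<epsilon>: "0 < \<epsilon>"
    "\<And>g. Vector_Spaces.linear sV sW g \<Longrightarrow> basis_norm (\<lambda>x. g x - f x) < \<epsilon> \<Longrightarrow>
      \<exists>w. s (\<lambda>x. q (exp_neg_ad w (g x))) = 0 \<and> basis_norm (\<lambda>x. exp_neg_ad w (g x) - f x) \<le> \<kappa>"
    using normalizing_conjugation[OF s \<kappa>(1)] by blast
  have "\<exists>w. range g \<subseteq> exp_end sW (\<nu> w) ` U"
    if hom: "lie_hom sV \<mu> sW \<nu> g" and close: "basis_norm (\<lambda>x. g x - f x) < \<epsilon>" for g
  proof -
    have g: "Vector_Spaces.linear sV sW g" "\<And>x y. g (\<mu> x y) = \<nu> (g x) (g y)"
      using hom by (auto simp: lie_hom_def)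
    obtain w where w: "s (\<lambda>x. q (exp_neg_ad w (g x))) = 0" "basis_norm (\<lambda>x. exp_neg_ad w (g x) - f x) \<le> \<kappa>"
      using \<epsilon>(2)[OF g(1) close] by blast
    have "lie_hom sV \<mu> sW \<nu> (\<lambda>x. exp_neg_ad w (g x))"
      using Vector_Spaces.linear_compose[OF g(1) exp_neg_ad_linear] by (simp add: lie_hom_def comp_def g(2) exp_neg_ad_bracket)
    then have "exp_neg_ad w (g x) \<in> U" for x
      using \<kappa>(2) w by blast
    then have "g x \<in> exp_end sW (\<nu> w) ` U" for x
      by (rule image_eqI[rotated]) (simp add: exp_ad_exp_neg_ad)
    then show ?thesis
      by blast
  qed
  then show ?thesis
    using \<epsilon>(1) by blast
qed

end

section \<open>First cohomology with values in the quotient module\<close>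

text \<open>
  The linear map \<open>c\<close> induces a \<open>1\<close>-cocycle with values in the module of cosets.  Vanishing cohomology says that its
  class, the coset of \<open>c\<close>, is the set of coboundaries.  The coset contains \<open>c\<close> because \<open>0\<close> is a coboundary.
\<close>

lemma H1_vanishing_cocycle_coboundary:
  fixes c :: "'v::ab_group_add \<Rightarrow> 'w::ab_group_add"
  assumes lieV: "lie_algebra sV \<mu>" and lieW: "lie_algebra sW \<nu>"
    and sub_U: "lie_subalgebra sW \<nu> U" and f_U: "\<And>x. f x \<in> U"
    and H1: "ce_cohomology_vanishes sV \<mu> (quotient_module sW U) (quotient_action \<nu> f U) 1"
    and c: "Vector_Spaces.linear sV sW c"
    and cocycle: "\<And>x y. \<nu> (f x) (c y) - \<nu> (f y) (c x) - c (\<mu> x y) \<in> U"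
  shows "\<exists>w. \<forall>x. c x - \<nu> (f x) w \<in> U"
proof -
  interpret LW: lie_algebra sW \<nu> by fact
  have subspace: "LW.subspace U"
    using sub_U by (simp add: lie_subalgebra_def)
  note vsW = LW.vector_space_axioms
  define M where "M = quotient_module sW U"
  define act where "act = quotient_action \<nu> f U"
  interpret M: abelian_group M
    unfolding M_def by (rule abelian_group_quotient_module[OF vsW subspace])
  have carrier [simp]: "a +o U \<in> carrier M" for a
    by (simp add: M_def quotient_module_def)
  have zero: "\<zero>\<^bsub>M\<^esub> = 0 +o U"
    by (simp add: M_def quotient_module_def)
  have add [simp]: "(a +o U) \<oplus>\<^bsub>M\<^esub> (b +o U) = (a + b) +o U" for a b
    unfolding M_def by (rule quotient_module_add[OF vsW subspace])
  have smult [simp]: "k \<odot>\<^bsub>M\<^esub> (a +o U) = sW k a +o U" for k a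
    unfolding M_def by (rule quotient_module_smult[OF vsW subspace])
  have act [simp]: "act x (a +o U) = \<nu> (f x) a +o U" for x a
    unfolding act_def using vsW subspace lieW sub_U f_U by (rule quotient_action_coset[where f=f])
  have coset_eq: "a +o U = b +o U \<longleftrightarrow> a - b \<in> U" for a b
    by (rule coset_eq_iff[OF vsW subspace])

  \<comment> \<open>A \<open>0\<close>-cochain is the choice of a coset, so the coboundaries can be listed.\<close>
  define \<eta> where "\<eta> w = (\<lambda>xs\<in>{xs :: 'v list. length xs = 0}. w +o U)" for w
  have \<eta>: "\<eta> w \<in> ce_cochains sV M 0" for w
    by (auto simp: \<eta>_def ce_cochains_def)
  have d_\<eta>: "ce_differential \<mu> M act 0 (\<eta> w) = (\<lambda>xs\<in>{xs. length xs = 1}. \<nu> (f (hd xs)) w +o U)" for w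
  proof -
    have empty: "{(i, j). i < j \<and> j = (0::nat)} = {}"
      by auto
    have "ce_differential \<mu> M act 0 (\<eta> w) xs = \<nu> (f (hd xs)) w +o U" if len: "length xs = 1" for xs
    proof -
      obtain x where "xs = [x]"
        using len by (cases xs) auto
      then show ?thesis
        by (simp add: ce_differential_def empty \<eta>_def atMost_0 M.finsum_insert M.finsum_empty nths_Cons)
    qed
    then show ?thesis
      by (auto simp: ce_differential_def fun_eq_iff)
  qed
  have cochain_0: "\<exists>w. \<omega> = \<eta> w" if "\<omega> \<in> ce_cochains sV M 0" for \<omega>
  proof -
    have "\<omega> [] \<in> carrier M" "\<omega> \<in> extensional {xs. length xs = 0}"
      using that by (auto simp: ce_cochains_def PiE_def)
    then obtain w where "\<omega> [] = w +o U"
      by (auto simp: M_def quotient_module_def)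
    then have "\<omega> = \<eta> w"
      using \<open>\<omega> \<in> extensional _\<close> by (auto simp: \<eta>_def fun_eq_iff extensional_def)
    then show ?thesis ..
  qed
  have coboundaries: "ce_coboundaries sV \<mu> M act 1 = range (\<lambda>w. \<lambda>xs\<in>{xs. length xs = 1}. \<nu> (f (hd xs)) w +o U)"
  proof -
    have "ce_cochains sV M 0 = range \<eta>"
      using \<eta> cochain_0 by blast
    then show ?thesis
      by (simp add: One_nat_def image_image d_\<eta>)
  qed

  define \<omega> where "\<omega> = (\<lambda>xs\<in>{xs. length xs = 1}. c (hd xs) +o U)"
  have \<omega>_1: "\<omega> [x] = c x +o U" for x
    by (simp add: \<omega>_def)
  have \<omega>_cochain: "\<omega> \<in> ce_cochains sV M 1"
    unfolding ce_cochains_def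
  proof (intro CollectI conjI allI impI)
    show "\<omega> \<in> {xs. length xs = 1} \<rightarrow>\<^sub>E carrier M"
      by (auto simp: \<omega>_def)
  next
    fix xs :: "'v list" and i :: nat and x y
    assume "length xs = 1 \<and> i < 1"
    then have "xs[i := z] = [z]" for z
      by (cases xs) auto
    then show "\<omega> (xs[i := x + y]) = \<omega> (xs[i := x]) \<oplus>\<^bsub>M\<^esub> \<omega> (xs[i := y])"
      by (simp add: \<omega>_1 lin_add[OF c])
  next
    fix xs :: "'v list" and i :: nat and k x
    assume "length xs = 1 \<and> i < 1"
    then have "xs[i := z] = [z]" for z
      by (cases xs) auto
    then show "\<omega> (xs[i := sV k x]) = k \<odot>\<^bsub>M\<^esub> \<omega> (xs[i := x])"
      by (simp add: \<omega>_1 lin_scale[OF c])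
  qed auto
  have "ce_differential \<mu> M act 1 \<omega> xs = \<zero>\<^bsub>M\<^esub>" if len: "length xs = 2" for xs
  proof -
    obtain x y where xs: "xs = [x, y]"
      using len by (auto simp: length_Suc_conv numeral_2_eq_2)
    have pairs: "{(i, j). i < j \<and> j \<le> Suc 0} = {(0, 1)}"
      by auto
    have "ce_differential \<mu> M act 1 \<omega> xs =
        (\<nu> (f x) (c y) - \<nu> (f y) (c x) - c (\<mu> x y)) +o U"
      by (simp add: ce_differential_def xs atMost_Suc pairs \<omega>_1 nths_Cons M.finsum_insert M.finsum_empty)
    also have "\<dots> = \<zero>\<^bsub>M\<^esub>"
      using cocycle by (simp add: zero coset_eq del: set_zero_plus)
    finally show ?thesis .
  qed
  then have "\<omega> \<in> ce_cocycles sV \<mu> M act 1"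
    using \<omega>_cochain by (auto simp: ce_cocycles_def ce_differential_def fun_eq_iff)
  then have "(\<lambda>\<beta>. \<lambda>xs\<in>{xs. length xs = 1}. \<omega> xs \<oplus>\<^bsub>M\<^esub> \<beta> xs) ` ce_coboundaries sV \<mu> M act 1 =
      ce_coboundaries sV \<mu> M act 1"
    using H1 unfolding ce_cohomology_vanishes_def ce_cohomology_def M_def act_def by blast
  moreover have "\<omega> \<in> (\<lambda>\<beta>. \<lambda>xs\<in>{xs. length xs = 1}. \<omega> xs \<oplus>\<^bsub>M\<^esub> \<beta> xs) ` ce_coboundaries sV \<mu> M act 1"
    unfolding coboundaries
    by (rule image_eqI[OF _ rangeI[of _ 0]]) (auto simp: \<omega>_def lin_zero[OF LW.linear_right] fun_eq_iff simp del: set_zero_plus)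
  ultimately obtain w where "\<omega> = (\<lambda>xs\<in>{xs. length xs = 1}. \<nu> (f (hd xs)) w +o U)"
    unfolding coboundaries by blast
  then have "\<omega> [x] = \<nu> (f x) w +o U" for x
    by simp
  then have "c x - \<nu> (f x) w \<in> U" for x
    unfolding \<omega>_1 coset_eq .
  then show ?thesis
    by blast
qed

section \<open>Topology and conclusion\<close>

lemma (in fd_space) continuous_map_vnorm_diff:
  "continuous_map (fd_topology scale) euclideanreal (\<lambda>x. vnorm (x - a))"
proof -
  have "continuous_map (fd_topology scale) euclidean (coord b)" for b
    using openin_functional_vimage[OF functional_coord] by (auto simp: continuous_map vimage_def)
  then have "continuous_map (fd_topology scale) euclideanreal (\<lambda>x. norm (coord b x - coord b a))" for b
    by (intro continuous_map_norm continuous_map_diff) auto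
  then have "continuous_map (fd_topology scale) euclideanreal (\<lambda>x. \<Sum>b\<in>Basis. norm (coord b x - coord b a))"
    by (intro continuous_map_sum finite_Basis)
  then show ?thesis
    by (simp add: vnorm_def lin_diff[OF functional_coord])
qed

lemma (in unobstructed_lie_hom) openin_basis_norm_ball:
  "openin (linear_map_topology sV sW) {g. Vector_Spaces.linear sV sW g \<and> basis_norm (\<lambda>x. g x - f x) < \<epsilon>}"
proof -
  let ?P = "product_topology (\<lambda>_. fd_topology sW) (UNIV :: 'v set)"
  have "continuous_map ?P euclideanreal (\<lambda>g. W.vnorm (g b - f b))" for b
    using continuous_map_compose[OF continuous_map_product_projection[of b UNIV "\<lambda>_. fd_topology sW"]
      W.continuous_map_vnorm_diff[of "f b"]] by (simp add: comp_def)
  then have "continuous_map ?P euclideanreal (\<lambda>g. basis_norm (\<lambda>x. g x - f x))"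
    unfolding basis_norm_def by (intro continuous_map_sum V.finite_Basis)
  then have "openin ?P {g \<in> topspace ?P. basis_norm (\<lambda>x. g x - f x) \<in> {..<\<epsilon>}}"
    by (rule openin_continuous_map_preimage) simp
  then show ?thesis
    unfolding linear_map_topology_def openin_subtopology by (auto intro!: exI)
qed

lemma topspace_quotient_topology: "topspace (quotient_topology X p) = p ` topspace X"
proof
  show "topspace (quotient_topology X p) \<subseteq> p ` topspace X"
    using openin_topspace[of "quotient_topology X p"] unfolding openin_quotient_topology by blast
  have "{x \<in> topspace X. p x \<in> p ` topspace X} = topspace X"
    by auto
  then have "openin (quotient_topology X p) (p ` topspace X)"
    by (simp add: openin_quotient_topology)
  then show "p ` topspace X \<subseteq> topspace (quotient_topology X p)"
    by (rule openin_subset)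
qed

theorem theorem3p27:
  fixes sV :: "'k::real_or_complex \<Rightarrow> 'v::ab_group_add \<Rightarrow> 'v"
    and sW :: "'k \<Rightarrow> 'w::ab_group_add \<Rightarrow> 'w"
    and BV :: "'v set" and BW :: "'w set"
    and \<mu> :: "'v \<Rightarrow> 'v \<Rightarrow> 'v" and \<nu> :: "'w \<Rightarrow> 'w \<Rightarrow> 'w"
    and f :: "'v \<Rightarrow> 'w" and U :: "'w set"
  assumes fdV: "finite_dimensional_vector_space sV BV"
    and fdW: "finite_dimensional_vector_space sW BW"
    and lieV: "lie_algebra sV \<mu>"
    and lieW: "lie_algebra sW \<nu>"
    and hom_f: "lie_hom sV \<mu> sW \<nu> f"
    and sub_U: "lie_subalgebra sW \<nu> U"
    and f_U: "range f \<subseteq> U"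
    and H1: "ce_cohomology_vanishes sV \<mu> (quotient_module sW U) (quotient_action \<nu> f U) 1"
  shows "\<exists>\<U>. openin (subtopology (linear_map_topology sV sW) {g. lie_hom sV \<mu> sW \<nu> g}) \<U> \<and> f \<in> \<U> \<and>
    (\<forall>f'\<in>\<U>. \<exists>P (\<phi> :: 'w set \<Rightarrow> 'w) I.
       openin (subtopology (quotient_topology (fd_topology sW) (\<lambda>w. w +o U))
                 {w +o U | w. \<forall>v. \<nu> w (f v) \<in> U}) P \<and>
       \<zero>\<^bsub>quotient_module sW U\<^esub> \<in> P \<and>
       I = \<phi> ` P \<and>
       (\<forall>w\<in>I. range f' \<subseteq> exp_end sW (\<nu> w) ` U))"
proof -
  interpret V: fd_space sV BV
    using fdV by (rule fd_space.intro)
  interpret W: fd_space sW BW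
    using fdW by (rule fd_space.intro)
  interpret LW: lie_algebra sW \<nu>
    by fact
  have f: "f x \<in> U" for x
    using f_U by blast
  have subspace: "W.subspace U"
    using sub_U by (simp add: lie_subalgebra_def)
  obtain q where q: "Vector_Spaces.linear sW sW q" "\<And>x. q x = 0 \<longleftrightarrow> x \<in> U" "\<And>x. q (q x) = q x"
    using exists_projection_along[OF W.vector_space_axioms subspace] by blast
  interpret unobstructed_lie_hom sV BV sW BW \<mu> \<nu> f U q
  proof (intro unobstructed_lie_hom.intro unobstructed_lie_hom_axioms.intro)
    fix c assume c: "Vector_Spaces.linear sV sW c"
      and cocycle: "\<And>x y. q (\<nu> (f x) (c y) - \<nu> (f y) (c x) - c (\<mu> x y)) = 0"
    from H1_vanishing_cocycle_coboundary[OF lieV lieW sub_U f H1 c cocycle[unfolded q(2)]]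
    obtain w where "\<forall>x. c x - \<nu> (f x) w \<in> U"
      by blast
    then have "\<forall>x. q (c x) = q (\<nu> (f x) w)"
      by (simp add: lin_diff[OF q(1)] flip: q(2))
    then show "\<exists>w. \<forall>x. q (c x) = q (\<nu> (f x) w)" ..
  qed (fact V.fd_space_axioms W.fd_space_axioms lieV lieW hom_f sub_U f q)+
  obtain \<epsilon> where \<epsilon>: "0 < \<epsilon>" "\<And>g. lie_hom sV \<mu> sW \<nu> g \<Longrightarrow> basis_norm (\<lambda>x. g x - f x) < \<epsilon> \<Longrightarrow>
      \<exists>w. range g \<subseteq> exp_end sW (\<nu> w) ` U"
    using close_hom_conjugate_into_U by blast
  define N where "N = {g. Vector_Spaces.linear sV sW g \<and> basis_norm (\<lambda>x. g x - f x) < \<epsilon>}"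
  let ?H = "{w +o U | w. \<forall>v. \<nu> w (f v) \<in> U}"
  show ?thesis
  proof (intro exI[of _ "N \<inter> {g. lie_hom sV \<mu> sW \<nu> g}"] conjI ballI)
    show "openin (subtopology (linear_map_topology sV sW) {g. lie_hom sV \<mu> sW \<nu> g}) (N \<inter> {g. lie_hom sV \<mu> sW \<nu> g})"
      unfolding openin_subtopology N_def using openin_basis_norm_ball by blast
    show "f \<in> N \<inter> {g. lie_hom sV \<mu> sW \<nu> g}"
      using hom_f f_linear \<epsilon>(1) by (simp add: N_def basis_norm_def)
    fix f' assume "f' \<in> N \<inter> {g. lie_hom sV \<mu> sW \<nu> g}"
    then have "lie_hom sV \<mu> sW \<nu> f'" "basis_norm (\<lambda>x. f' x - f x) < \<epsilon>"
      by (auto simp: N_def)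
    then obtain w where w: "range f' \<subseteq> exp_end sW (\<nu> w) ` U"
      using \<epsilon>(2) by blast
    show "\<exists>P (\<phi> :: 'w set \<Rightarrow> 'w) I.
       openin (subtopology (quotient_topology (fd_topology sW) (\<lambda>w. w +o U)) ?H) P \<and>
       \<zero>\<^bsub>quotient_module sW U\<^esub> \<in> P \<and> I = \<phi> ` P \<and> (\<forall>w\<in>I. range f' \<subseteq> exp_end sW (\<nu> w) ` U)"
      \<comment> \<open>The family is constant: its one element \<open>w\<close> serves for the whole parameter space.\<close>
    proof (intro exI[of _ ?H] exI[of _ "\<lambda>_. w"] exI[of _ "(\<lambda>_. w) ` ?H"] conjI ballI)
      show "openin (subtopology (quotient_topology (fd_topology sW) (\<lambda>w. w +o U)) ?H) ?H"
        by (auto simp: openin_subtopology_refl topspace_quotient_topology)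
      have "\<forall>v. \<nu> 0 (f v) \<in> U"
        using W.subspace_0[OF subspace] by (simp add: lin_zero[OF LW.linear_left])
      then show "\<zero>\<^bsub>quotient_module sW U\<^esub> \<in> ?H"
        by (intro CollectI exI[of _ 0]) (simp add: quotient_module_def)
    qed (use w in auto)
  qed
qed

end
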